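(* Let $p,q,r\ge 1$ be integers, $\lambda>0$, and let $f:\mathbb{R}^{p\times q}\to\mathbb{R}$ be a convex, twice continuously differentiable function that satisfies the $(2r,4r)$-restricted well-conditionedness property with constants $m,M>0$: for all $X,D\in\mathbb{R}^{p\times q}$ with $\operatorname{rank}(X)\le 2r$ and $\operatorname{rank}(D)\le 4r$, $$m\|D\|_F^2\le[\nabla^2 f(X)](D,D)\le M\|D\|_F^2,\qquad\text{and}\qquad \frac{M}{m}\le 1.5 .$$ Let $X^\star$ be an optimal solution of the convex problem $\min_{X\in\mathbb{R}^{p\times q}} f(X)+\lambda\|X\|_*$, let $r^\star=\operatorname{rank}(X^\star)$, and assume $r\ge r^\star$. For $U\in\mathbb{R}^{p\times r}$, $V\in\mathbb{R}^{q\times r}$ and $W=\begin{bmatrix}U \\ V\end{bmatrix}\in\mathbb{R}^{(p+q)\times r}$ define $$g(W)=g(U,V)=f(UV^T)+\frac{\lambda}{2}\left(\|U\|_F^2+\|V\|_F^2\right).$$ Let $(U,V)$ be any critical point of $g$, i.e. $\nabla g(U,V)=\mathbf 0$, and let $W=\begin{bmatrix}U \\ V\end{bmatrix}$. Then either $UV^T=X^\star$, or $(U,V)$ is a strict saddle of $g$, i.e. $\lambda_{\min}(\nabla^2 g(W))<0$; more precisely, in the latter case, $$\lambda_{\min}(\nabla^2 g(W))\le\begin{cases}-0.12\,m\min\{0.5\,\rho(W)^2,\ \rho(X^\star)\}, & \text{if } r\ge r^\star, \\ -0.099\,m\,\rho(X^\star), & \text{if } r=r^\star, \\ -0.12\,m\,\rho(X^\star),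 & \text{if } W=\mathbf 0,\end{cases}$$ where each bound holds whenever its stated condition holds.
   Context: $\|\cdot\|_F$ and $\|\cdot\|_*$ denote the Frobenius and nuclear norms. For a nonzero matrix $Y$, $\rho(Y)$ denotes the smallest nonzero singular value of $Y$; by convention $\rho(\mathbf 0)=0$. The Hessian of a twice continuously differentiable function $h$ of a matrix variable $Z$ is viewed as the bilinear form $[\nabla^2 h(Z)](G,H)=\sum_{i,j,k,l}\frac{\partial^2 h(Z)}{\partial Z_{ij}\partial Z_{kl}}G_{ij}H_{kl}$, or equivalently as the symmetric matrix of second partial derivatives with respect to the vectorization of $Z$; $\lambda_{\min}(\nabla^2 h(Z))$ is the smallest eigenvalue of this matrix. A critical point of $h$ is a point where the gradient vanishes; a critical point is a strict saddle if the Hessian there has a strictly negative eigenvalue. *)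

theory Defs
  imports "HOL-Analysis.Analysis"
begin

text \<open>A \<open>p \<times> q\<close> matrix has type \<open>real^'q^'p\<close> with \<open>p = CARD('p)\<close>, \<open>q = CARD('q)\<close> (both are
  automatically \<open>\<ge> 1\<close>). On this type \<open>norm\<close> is the Frobenius norm.\<close>

lemma norm_eq_frobenius:
  fixes A :: "real^'n^'m"
  shows "norm A = sqrt (\<Sum>i\<in>UNIV. \<Sum>j\<in>UNIV. (A $ i $ j)\<^sup>2)"
  by (simp add: norm_vec_def L2_set_def sum_nonneg)


section \<open>Eigenvalues and singular values\<close>

definition eigenvalue :: "real^'n^'n \<Rightarrow> real \<Rightarrow> bool" where
  "eigenvalue A \<mu> \<longleftrightarrow> (\<exists>v. v \<noteq> 0 \<and> A *v v = \<mu> *\<^sub>R v)"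

definition lambda_min :: "real^'n^'n \<Rightarrow> real" where
  "lambda_min A = Min {\<mu>. eigenvalue A \<mu>}"

definition singular_value :: "real^'n^'m \<Rightarrow> real \<Rightarrow> bool" where
  "singular_value A s \<longleftrightarrow> s \<ge> 0 \<and> eigenvalue (transpose A ** A) (s\<^sup>2)"

definition rho :: "real^'n^'m \<Rightarrow> real" where
  "rho A = (if A = 0 then 0 else Min {s. singular_value A s \<and> s \<noteq> 0})"

text \<open>The nuclear norm is the sum of the singular values; each of them is counted as often as
  its multiplicity, the dimension of the corresponding eigenspace of \<open>A\<^sup>T A\<close>.\<close>

definition nuclear_norm :: "real^'n^'m \<Rightarrow> real" where
  "nuclear_norm A =
     (\<Sum>s | singular_value A s. real (dim {v. (transpose A ** A) *v v = s\<^sup>2 *\<^sub>R v}) * s)"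

text \<open>The following facts show that the finite sum and the minima above are meaningful.\<close>

lemma symmetric_inner_matrix:
  fixes A :: "real^'n^'n"
  assumes "transpose A = A"
  shows "(A *v x) \<bullet> y = x \<bullet> (A *v y)"
  by (metis assms dot_lmul_matrix vector_transpose_matrix)

lemma finite_eigenvalues:
  fixes A :: "real^'n^'n"
  assumes "transpose A = A"
  shows "finite {\<mu>. eigenvalue A \<mu>}"
proof -
  let ?E = "{\<mu>. eigenvalue A \<mu>}"
  obtain e where e: "\<And>\<mu>. \<mu> \<in> ?E \<Longrightarrow> e \<mu> \<noteq> 0 \<and> A *v e \<mu> = \<mu> *\<^sub>R e \<mu>"
    using bchoice[of ?E "\<lambda>\<mu> v. v \<noteq> 0 \<and> A *v v = \<mu> *\<^sub>R v"]
    by (auto simp: eigenvalue_def)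
  have orth: "e \<mu> \<bullet> e \<nu> = 0" if "\<mu> \<in> ?E" "\<nu> \<in> ?E" "\<mu> \<noteq> \<nu>" for \<mu> \<nu>
  proof -
    have "\<mu> * (e \<mu> \<bullet> e \<nu>) = \<nu> * (e \<mu> \<bullet> e \<nu>)"
      using symmetric_inner_matrix[OF assms, of "e \<mu>" "e \<nu>"] e[OF that(1)] e[OF that(2)] by simp
    then show ?thesis using that(3) by simp
  qed
  have inj: "inj_on e ?E"
    by (rule inj_onI) (metis e orth inner_eq_zero_iff)
  have "pairwise orthogonal (e ` ?E)"
    unfolding pairwise_def orthogonal_def using orth by blast
  moreover have "0 \<notin> e ` ?E"
    using e by fastforce
  ultimately have "independent (e ` ?E)"
    by (rule pairwise_orthogonal_independent)
  then show ?thesis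
    using inj independent_imp_finite finite_imageD by blast
qed

lemma ex_max_eigenvalue:
  fixes A :: "real^'n^'n"
  assumes sym: "transpose A = A"
  shows "\<exists>\<mu>. eigenvalue A \<mu> \<and> (\<forall>x. x \<bullet> (A *v x) \<le> \<mu> * (x \<bullet> x))"
proof -
  have "continuous_on (sphere 0 1) (\<lambda>x. x \<bullet> (A *v x))"
    by (intro continuous_intros linear_continuous_on_compose matrix_vector_mul_linear)
  moreover have "sphere (0::real^'n) 1 \<noteq> {}" by simp
  ultimately obtain v where v: "norm v = 1"
    and mx: "\<And>y. norm y = 1 \<Longrightarrow> y \<bullet> (A *v y) \<le> v \<bullet> (A *v v)"
    using continuous_attains_sup[of "sphere (0::real^'n) 1" "\<lambda>x. x \<bullet> (A *v x)"] by auto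
  define \<mu> where "\<mu> = v \<bullet> (A *v v)"
  have bound: "x \<bullet> (A *v x) \<le> \<mu> * (x \<bullet> x)" for x
  proof (cases "x = 0")
    case False
    have "(x /\<^sub>R norm x) \<bullet> (A *v (x /\<^sub>R norm x)) \<le> \<mu>"
      unfolding \<mu>_def using False by (intro mx) simp
    then have "(x \<bullet> (A *v x)) / (x \<bullet> x) \<le> \<mu>"
      by (simp add: matrix_vector_mult_scaleR divide_simps power2_norm_eq_inner[symmetric] power2_eq_square)
    then show ?thesis using False by (simp add: divide_simps split: if_splits)
  qed simp
  define y where "y = A *v v - \<mu> *\<^sub>R v"
  define c where "c = y \<bullet> (A *v y) - \<mu> * (y \<bullet> y)"
  have vv: "v \<bullet> v = 1" using v by (simp add: norm_eq_1)
  have quad: "2 * t * (y \<bullet> y) + t\<^sup>2 * c \<le> 0" for t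
  proof -
    have 1: "v \<bullet> (A *v y) = (A *v v) \<bullet> y" using symmetric_inner_matrix[OF sym] by metis
    have 2: "(A *v v) \<bullet> y = y \<bullet> y + \<mu> * (v \<bullet> y)" by (simp add: y_def algebra_simps)
    have "(v + t *\<^sub>R y) \<bullet> (A *v (v + t *\<^sub>R y)) - \<mu> * ((v + t *\<^sub>R y) \<bullet> (v + t *\<^sub>R y))
        = \<mu> + 2 * t * ((A *v v) \<bullet> y) + t\<^sup>2 * (y \<bullet> (A *v y))
          - \<mu> * (1 + 2 * t * (v \<bullet> y) + t\<^sup>2 * (y \<bullet> y))"
      by (simp add: matrix_vector_right_distrib matrix_vector_mult_scaleR inner_add_left
          inner_add_right 1 vv flip: \<mu>_def)
        (simp add: algebra_simps power2_eq_square inner_commute)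
    also have "\<dots> = 2 * t * (y \<bullet> y) + t\<^sup>2 * c"
      unfolding 2 c_def by (simp add: algebra_simps)
    finally show ?thesis using bound[of "v + t *\<^sub>R y"] by linarith
  qed
  have "y \<bullet> y = 0"
  proof (rule ccontr)
    assume "y \<bullet> y \<noteq> 0"
    then have pos: "y \<bullet> y > 0" by simp
    define t where "t = (y \<bullet> y) / (1 + \<bar>c\<bar>)"
    have t: "t > 0" "t * (1 + \<bar>c\<bar>) = y \<bullet> y" using pos by (simp_all add: t_def add_pos_nonneg)
    have "2 * (y \<bullet> y) + t * c \<le> 0"
      using quad[of t] t(1) by (simp add: power2_eq_square mult.assoc flip: distrib_left)
        (metis mult.left_commute distrib_left mult_le_0_iff not_le)
    moreover have "t * c \<ge> - (t * \<bar>c\<bar>)" using t(1)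
      by (metis abs_ge_minus_self abs_mult abs_of_pos neg_le_iff_le minus_minus)
    moreover have "t * \<bar>c\<bar> = y \<bullet> y - t"
      using t(2) by (simp only: distrib_left mult_1_right flip: t(2))
    ultimately show False using t(1) pos by linarith
  qed
  then have "A *v v = \<mu> *\<^sub>R v" by (simp add: y_def)
  moreover have "v \<noteq> 0" using v by auto
  ultimately show ?thesis using bound eigenvalue_def by blast
qed

lemma symmetric_gram: "transpose (transpose A ** A) = transpose A ** (A :: real^'n^'m)"
  by (simp add: matrix_transpose_mul)

lemma finite_singular_values: "finite {s. singular_value A s}"
proof (rule finite_imageD)
  show "finite ((\<lambda>s. s\<^sup>2) ` {s. singular_value A s})"
    by (rule finite_subset[OF _ finite_eigenvalues[OF symmetric_gram, of A]])
      (auto simp: singular_value_def)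
  show "inj_on (\<lambda>s. s\<^sup>2) {s. singular_value A s}"
    by (auto simp: inj_on_def singular_value_def)
qed

lemma ex_nonzero_singular_value:
  fixes A :: "real^'n^'m"
  assumes "A \<noteq> 0"
  shows "\<exists>s. singular_value A s \<and> s \<noteq> 0"
proof -
  obtain \<mu> where \<mu>: "eigenvalue (transpose A ** A) \<mu>"
    and le: "\<And>x. x \<bullet> ((transpose A ** A) *v x) \<le> \<mu> * (x \<bullet> x)"
    using ex_max_eigenvalue[OF symmetric_gram[of A]] by blast
  have "\<exists>x. A *v x \<noteq> 0"
    using assms matrix_eq[of A 0] by auto
  then obtain x where x: "A *v x \<noteq> 0" ..
  have "x \<bullet> ((transpose A ** A) *v x) = (A *v x) \<bullet> (A *v x)"
    by (metis dot_lmul_matrix inner_commute matrix_vector_mul_assoc vector_transpose_matrix)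
  then have "0 < \<mu> * (x \<bullet> x)" using le[of x] x
    by (metis inner_gt_zero_iff order_less_le_trans)
  then have "\<mu> > 0" by (simp add: zero_less_mult_iff inner_ge_zero leD)
  then show ?thesis using \<mu>
    by (intro exI[of _ "sqrt \<mu>"]) (simp add: singular_value_def)
qed


section \<open>Differential calculus for functions of a matrix variable\<close>

definition twice_continuously_differentiable :: "('a::real_normed_vector \<Rightarrow> real) \<Rightarrow> bool" where
  "twice_continuously_differentiable h \<longleftrightarrow>
     (\<exists>(h' :: 'a \<Rightarrow> 'a \<Rightarrow>\<^sub>L real) (h'' :: 'a \<Rightarrow> 'a \<Rightarrow>\<^sub>L ('a \<Rightarrow>\<^sub>L real)).
        (\<forall>Z. (h has_derivative blinfun_apply (h' Z)) (at Z)) \<and>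
        (\<forall>Z. (h' has_derivative blinfun_apply (h'' Z)) (at Z)) \<and>
        continuous_on UNIV h'')"

text \<open>\<open>axis i (axis j 1)\<close> is the matrix unit whose only nonzero entry is in position \<open>(i, j)\<close>.\<close>

definition partial_deriv :: "'m \<Rightarrow> 'n \<Rightarrow> (real^'n^'m \<Rightarrow> real) \<Rightarrow> real^'n^'m \<Rightarrow> real" where
  "partial_deriv i j h Z = deriv (\<lambda>t. h (Z + t *\<^sub>R axis i (axis j 1))) 0"

definition gradient :: "(real^'n^'m \<Rightarrow> real) \<Rightarrow> real^'n^'m \<Rightarrow> real^'n^'m" where
  "gradient h Z = (\<chi> i j. partial_deriv i j h Z)"

definition hessian_form ::
    "(real^'n^'m \<Rightarrow> real) \<Rightarrow> real^'n^'m \<Rightarrow> real^'n^'m \<Rightarrow> real^'n^'m \<Rightarrow> real" where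
  "hessian_form h Z G H =
     (\<Sum>i\<in>UNIV. \<Sum>j\<in>UNIV. \<Sum>k\<in>UNIV. \<Sum>l\<in>UNIV.
        partial_deriv i j (partial_deriv k l h) Z * G $ i $ j * H $ k $ l)"

text \<open>The Hessian with respect to the vectorization of \<open>Z\<close>, whose coordinates are indexed by pairs
  \<open>(i, j)\<close>.\<close>

definition hessian_matrix ::
    "(real^'n^'m \<Rightarrow> real) \<Rightarrow> real^'n^'m \<Rightarrow> real^('m \<times> 'n)^('m \<times> 'n)" where
  "hessian_matrix h Z =
     (\<chi> a b. partial_deriv (fst a) (snd a) (partial_deriv (fst b) (snd b) h) Z)"

definition critical_point :: "(real^'n^'m \<Rightarrow> real) \<Rightarrow> real^'n^'m \<Rightarrow> bool" where
  "critical_point h Z \<longleftrightarrow> gradient h Z = 0"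

definition strict_saddle :: "(real^'n^'m \<Rightarrow> real) \<Rightarrow> real^'n^'m \<Rightarrow> bool" where
  "strict_saddle h Z \<longleftrightarrow>
     critical_point h Z \<and> (\<exists>\<mu>. eigenvalue (hessian_matrix h Z) \<mu> \<and> \<mu> < 0)"


section \<open>The optimization problems\<close>

definition restricted_well_conditioned ::
    "nat \<Rightarrow> nat \<Rightarrow> real \<Rightarrow> real \<Rightarrow> (real^'q^'p \<Rightarrow> real) \<Rightarrow> bool" where
  "restricted_well_conditioned a b m M f \<longleftrightarrow>
     (\<forall>X D. rank X \<le> a \<longrightarrow> rank D \<le> b \<longrightarrow>
        m * (norm D)\<^sup>2 \<le> hessian_form f X D D \<and> hessian_form f X D D \<le> M * (norm D)\<^sup>2) \<and>
     M / m \<le> 1.5"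

definition convex_optimal :: "(real^'q^'p \<Rightarrow> real) \<Rightarrow> real \<Rightarrow> real^'q^'p \<Rightarrow> bool" where
  "convex_optimal f lam X \<longleftrightarrow>
     (\<forall>Y. f X + lam * nuclear_norm X \<le> f Y + lam * nuclear_norm Y)"

text \<open>The \<open>p + q\<close> rows of the stacked matrix are indexed by the sum type.\<close>

definition stack :: "real^'r^'p \<Rightarrow> real^'r^'q \<Rightarrow> real^'r^('p::finite + 'q::finite)" where
  "stack U V = (\<chi> i. case i of Inl a \<Rightarrow> U $ a | Inr b \<Rightarrow> V $ b)"

definition upper_block :: "real^'r^('p::finite + 'q::finite) \<Rightarrow> real^'r^'p" where
  "upper_block W = (\<chi> a. W $ Inl a)"

definition lower_block :: "real^'r^('p::finite + 'q::finite) \<Rightarrow> real^'r^'q" where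
  "lower_block W = (\<chi> b. W $ Inr b)"

lemma stack_blocks [simp]:
  "upper_block (stack U V) = U" "lower_block (stack U V) = V"
  "stack (upper_block W) (lower_block W) = W"
  by (auto simp: stack_def upper_block_def lower_block_def vec_eq_iff split: sum.split)

definition factored_objective ::
    "(real^'q^'p \<Rightarrow> real) \<Rightarrow> real \<Rightarrow> real^'r^('p::finite + 'q::finite) \<Rightarrow> real" where
  "factored_objective f lam W =
     f (upper_block W ** transpose (lower_block W))
     + lam / 2 * ((norm (upper_block W))\<^sup>2 + (norm (lower_block W))\<^sup>2)"

end

theory Submission
  imports Defs
begin

text \<open>
  Write \<open>W = stack U V\<close> and \<open>X = U V\<^sup>T\<close>, and suppose \<open>X \<noteq> Xstar\<close>. The Hessian at \<open>W\<close> is strictly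
  negative in the direction \<open>D = W - Y\<close>, where \<open>Y\<close> is a balanced factorization of \<open>Xstar\<close>, rotated so
  as to lie as close as possible to \<open>W\<close>.

  The factorization comes from the singular value decomposition of \<open>Xstar\<close>, each singular value
  being split evenly between the two factors (\<open>balanced_svd_factorization\<close>). The nuclear norm of a
  product is at most half the sum of the squared Frobenius norms of its factors, with equality for
  the even split. Hence such a factor minimizes the factored objective globally, which makes it
  stationary, and perturbing \<open>Xstar\<close> by low-rank matrices gives a dual inequality for the gradient at
  \<open>Xstar\<close> (\<open>convex_optimal_factor\<close>). All of this is invariant under an orthogonal matrix acting from
  the right, and a suitable one makes \<open>W\<^sup>T Y\<close> symmetric and positive semidefinite
  (\<open>procrustes_alignment\<close>).

  The Hessian form at \<open>D\<close> is the second derivative of \<open>f\<close> in the direction \<open>L = U D\<^sub>V\<^sup>T + D\<^sub>U V\<^sup>T\<close>, plus a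
  term that is linear in the gradient of \<open>f\<close>. Stationarity at \<open>W\<close> and at \<open>Y\<close>, the dual inequality
  and restricted strong convexity bound the linear term by \<open>-2m \<parallel>X - Xstar\<parallel>\<^sup>2\<close>. The other term is at
  most \<open>M \<parallel>L\<parallel>\<^sup>2\<close>, and \<open>\<parallel>L\<parallel> \<le> \<parallel>D W\<^sup>T\<parallel>\<close> since stationary factors are balanced: \<open>U\<^sup>T U = V\<^sup>T V\<close>.

  The main point is to bound \<open>\<parallel>D W\<^sup>T\<parallel>\<close> with a small constant. Put \<open>E = W W\<^sup>T - Y Y\<^sup>T\<close> and let \<open>P\<close> be the
  orthogonal projection onto the range of \<open>W\<close>. Then \<open>\<parallel>D W\<^sup>T\<parallel>\<^sup>2 \<le> 1/8 \<parallel>E\<parallel>\<^sup>2 + 7/2 \<parallel>E P\<parallel>\<^sup>2\<close>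
  (\<open>difference_times_factor_bound\<close>). Balancedness gives \<open>\<parallel>E\<parallel>\<^sup>2 \<le> 4 \<parallel>X - Xstar\<parallel>\<^sup>2\<close>. The projected part is
  smaller: \<open>E P\<close> has the form \<open>Z W\<^sup>T\<close>, so \<open>Z\<close> is a direction in which criticality can be tested. As
  \<open>M \<le> 1.5 m\<close>, the Hessian of \<open>f\<close> is nearly a multiple of the identity on low-rank matrices, and the
  test yields \<open>\<parallel>E P\<parallel> \<le> 0.4 \<parallel>X - Xstar\<parallel>\<close>. In total the Hessian form at \<open>D\<close> is at most
  \<open>-0.41 m \<parallel>X - Xstar\<parallel>\<^sup>2\<close>, hence at most \<open>-0.1025 m \<parallel>E\<parallel>\<^sup>2\<close> (\<open>hessian_descent_direction\<close>).

  Each of the three eigenvalue bounds then follows from an inequality \<open>\<alpha> \<parallel>D\<parallel>\<^sup>2 \<le> \<parallel>E\<parallel>\<^sup>2\<close>. In general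
  \<open>\<alpha>\<close> may be any lower bound for the nonzero eigenvalues of \<open>W\<^sup>T W\<close> and \<open>Y\<^sup>T Y\<close>
  (\<open>gram_difference_ge_factor_difference\<close>); for \<open>Y\<close> these are at least twice \<open>rho Xstar\<close>. If \<open>Y\<close> has full
  column rank, its own eigenvalues suffice, up to the factor \<open>2/3\<close> (\<open>gram_difference_lower_bound\<close>).
\<close>

section \<open>Matrix products and the Frobenius inner product\<close>

lemma bounded_bilinear_matrix_mult:
  "bounded_bilinear ((**) :: real^'n^'m \<Rightarrow> real^'k^'n \<Rightarrow> real^'k^'m)"
proof (rule bilinear_conv_bounded_bilinear[THEN iffD1])
  show "bilinear ((**) :: real^'n^'m \<Rightarrow> real^'k^'n \<Rightarrow> real^'k^'m)"
    by (auto simp: bilinear_def matrix_matrix_mult_def vec_eq_iff algebra_simps sum.distrib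
        sum_distrib_left intro!: linearI)
qed

lemmas matrix_mult_distribs =
  bounded_bilinear.diff_left[OF bounded_bilinear_matrix_mult]
  bounded_bilinear.diff_right[OF bounded_bilinear_matrix_mult]
  bounded_bilinear.add_left[OF bounded_bilinear_matrix_mult]
  bounded_bilinear.add_right[OF bounded_bilinear_matrix_mult]
  bounded_bilinear.minus_left[OF bounded_bilinear_matrix_mult]
  bounded_bilinear.minus_right[OF bounded_bilinear_matrix_mult]
  bounded_bilinear.scaleR_left[OF bounded_bilinear_matrix_mult]
  bounded_bilinear.scaleR_right[OF bounded_bilinear_matrix_mult]

lemma linear_transpose: "linear (transpose :: real^'n^'m \<Rightarrow> real^'m^'n)"
  by (auto simp: transpose_def vec_eq_iff intro!: linearI)

lemmas transpose_distribs =
  linear_add[OF linear_transpose] linear_diff[OF linear_transpose]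
  linear_scale[OF linear_transpose] linear_neg[OF linear_transpose]

lemma inner_transpose: "transpose A \<bullet> transpose B = A \<bullet> (B :: real^'n^'m)"
  unfolding inner_vec_def transpose_def by (simp, subst sum.swap, simp)

lemma inner_matrix_mult_left:
  fixes A :: "real^'n^'m" and B :: "real^'k^'n"
  shows "(A ** B) \<bullet> C = A \<bullet> (C ** transpose B)"
proof -
  have "(A ** B) \<bullet> C = (\<Sum>i\<in>UNIV. \<Sum>j\<in>UNIV. \<Sum>l\<in>UNIV. A$i$l * B$l$j * C$i$j)"
    by (simp add: inner_vec_def matrix_matrix_mult_def sum_distrib_right)
  also have "\<dots> = (\<Sum>i\<in>UNIV. \<Sum>l\<in>UNIV. \<Sum>j\<in>UNIV. A$i$l * B$l$j * C$i$j)"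
    by (intro sum.cong refl sum.swap)
  also have "\<dots> = A \<bullet> (C ** transpose B)"
    by (simp add: inner_vec_def matrix_matrix_mult_def transpose_def sum_distrib_left mult_ac)
  finally show ?thesis .
qed

lemma inner_matrix_mult_right:
  fixes A :: "real^'n^'m" and B :: "real^'k^'n"
  shows "(A ** B) \<bullet> C = B \<bullet> (transpose A ** C)"
proof -
  have "(A ** B) \<bullet> C = (transpose B ** transpose A) \<bullet> transpose C"
    by (simp only: inner_transpose flip: matrix_transpose_mul)
  also have "\<dots> = transpose B \<bullet> transpose (transpose A ** C)"
    by (simp only: inner_matrix_mult_left matrix_transpose_mul transpose_transpose)
  finally show ?thesis by (simp only: inner_transpose)
qed

text \<open>
  This moves an inner product of two \<open>m \<times> n\<close> matrices to the Gram matrices of their thin factors,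
  where all the estimates below take place.
\<close>
lemma inner_outer_products:
  fixes A :: "real^'k^'m" and B :: "real^'k^'n" and C :: "real^'l^'m" and D :: "real^'l^'n"
  shows "(A ** transpose B) \<bullet> (C ** transpose D) = (transpose A ** C) \<bullet> (transpose B ** D)"
proof -
  have "(A ** transpose B) \<bullet> (C ** transpose D) = ((transpose A ** C) ** transpose D) \<bullet> transpose B"
    by (simp only: inner_matrix_mult_right[of A] matrix_mul_assoc inner_commute[of "transpose B"])
  then show ?thesis by (simp only: inner_matrix_mult_left[of "transpose A ** C"] transpose_transpose)
qed

section \<open>Factors and their Gram matrices\<close>

lemma norm_gram_difference:
  fixes W Y :: "real^'r^'n"
  shows "(norm (W ** transpose W - Y ** transpose Y))\<^sup>2
    = (norm (transpose W ** W))\<^sup>2 + (norm (transpose Y ** Y))\<^sup>2 - 2 * (norm (transpose W ** Y))\<^sup>2"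
proof -
  have "(Y ** transpose Y) \<bullet> (W ** transpose W) = (W ** transpose W) \<bullet> (Y ** transpose Y)"
    by (rule inner_commute)
  then show ?thesis
    by (simp add: power2_norm_eq_inner inner_diff_left inner_diff_right inner_outer_products)
qed

lemma matrix_mult_row: "((D::real^'r^'n) ** (S::real^'k^'r)) $ i = D $ i v* S"
  by (simp add: vec_eq_iff matrix_matrix_mult_def vector_matrix_mult_def mult.commute)

text \<open>
  The inner product is the sum of the values of the quadratic form of \<open>S\<close> at the rows of \<open>D\<close>.
\<close>
lemma psd_inner_gram_nonneg:
  fixes S :: "real^'r^'r" and D :: "real^'r^'n"
  assumes "\<And>x. 0 \<le> x \<bullet> (S *v x)"
  shows "0 \<le> S \<bullet> (transpose D ** D)"
proof -
  have "S \<bullet> (transpose D ** D) = (D ** S) \<bullet> D"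
    by (metis inner_commute inner_matrix_mult_right)
  also have "\<dots> = (\<Sum>i\<in>UNIV. D $ i \<bullet> (S *v D $ i))"
    by (simp add: inner_vec_def[of "D ** S"] matrix_mult_row dot_lmul_matrix)
  finally show ?thesis by (simp add: assms sum_nonneg)
qed

lemma gram_diff:
  fixes W Y :: "real^'r^'n"
  assumes "transpose (transpose W ** Y) = transpose W ** Y"
  shows "transpose (W - Y) ** (W - Y)
    = transpose W ** W + transpose Y ** Y - 2 *\<^sub>R (transpose W ** Y)"
proof -
  have "transpose Y ** W = transpose W ** Y"
    using assms by (simp add: matrix_transpose_mul)
  then show ?thesis
    by (simp add: matrix_mult_distribs transpose_distribs algebra_simps scaleR_2)
qed

lemma norm_matrix_mult_transpose:
  fixes D :: "real^'r^'n" and W :: "real^'r^'m"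
  shows "(norm (D ** transpose W))\<^sup>2 = (transpose D ** D) \<bullet> (transpose W ** W)"
  unfolding power2_norm_eq_inner by (rule inner_outer_products)

text \<open>
  With \<open>A = W\<^sup>T W\<close>, \<open>B = Y\<^sup>T Y\<close>, \<open>S = W\<^sup>T Y\<close>, \<open>G = A + B - 2 S\<close> (the Gram matrix of \<open>W - Y\<close>) and
  \<open>T = A - S\<close>, the right-hand side equals \<open>2 A\<bullet>G + 2 T\<bullet>T + G\<bullet>G - 4 T\<bullet>G\<close>. Completing the square as
  \<open>\<parallel>G - \<tau> T\<parallel>\<^sup>2\<close> leaves \<open>(2 \<tau> - 2) A\<bullet>G + (4 - 2 \<tau>) S\<bullet>G + (2 - \<tau>\<^sup>2) T\<bullet>T\<close>, and \<open>S\<bullet>G \<ge> 0\<close>. The best choice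
  is \<open>\<tau> = sqrt 2\<close>; the rational \<open>\<tau> = 4/3\<close> gives \<open>2/3\<close>.
\<close>
lemma gram_difference_lower_bound:
  fixes W Y :: "real^'r^'n"
  assumes sym: "transpose (transpose W ** Y) = transpose W ** Y"
    and psd: "\<And>x. 0 \<le> x \<bullet> ((transpose W ** Y) *v x)"
  shows "2/3 * (norm ((W - Y) ** transpose W))\<^sup>2
    \<le> (norm (W ** transpose W - Y ** transpose Y))\<^sup>2"
proof -
  define A where "A = transpose W ** W"
  define B where "B = transpose Y ** Y"
  define S where "S = transpose W ** Y"
  define G where "G = A + B - 2 *\<^sub>R S"
  define T where "T = A - S"
  have G: "transpose (W - Y) ** (W - Y) = G"
    using gram_diff[OF sym] by (simp add: G_def A_def B_def S_def)
  have "0 \<le> S \<bullet> G" using psd_inner_gram_nonneg[OF psd, of "W - Y"] by (simp add: S_def G)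
  moreover have "A \<bullet> A + B \<bullet> B - 2 * (S \<bullet> S)
     = (G - (4/3) *\<^sub>R T) \<bullet> (G - (4/3) *\<^sub>R T) + 2/9 * (T \<bullet> T) + 2/3 * (G \<bullet> A) + 4/3 * (S \<bullet> G)"
    by (simp add: G_def T_def inner_diff_left inner_diff_right inner_add_left inner_add_right
        inner_commute[of B A] inner_commute[of S A] inner_commute[of S B] field_simps)
  moreover have "0 \<le> (G - (4/3) *\<^sub>R T) \<bullet> (G - (4/3) *\<^sub>R T)" "0 \<le> T \<bullet> T" by simp_all
  ultimately have "2/3 * (G \<bullet> A) \<le> A \<bullet> A + B \<bullet> B - 2 * (S \<bullet> S)" by linarith
  then show ?thesis
    unfolding norm_gram_difference norm_matrix_mult_transpose G
    by (simp add: power2_norm_eq_inner A_def B_def S_def)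
qed

lemma column_matrix_mult: "column j ((A::real^'n^'m) ** (B::real^'k^'n)) = A *v column j B"
  by (simp add: vec_eq_iff column_def matrix_matrix_mult_def matrix_vector_mult_def)

text \<open>
  The columns of \<open>W ** K\<close> are the orthogonal projections of the columns of \<open>Y\<close> onto the range of
  \<open>W\<close>. Such a \<open>K\<close> stands in for the pseudo-inverse of \<open>W\<close>.
\<close>
lemma normal_equations_solvable:
  fixes W :: "real^'r^'n" and Y :: "real^'k^'n"
  shows "\<exists>K. transpose W ** W ** K = transpose W ** Y"
proof -
  have "\<exists>x. transpose W *v (W *v x) = transpose W *v y" for y
  proof -
    have sub: "subspace (range ((*v) W))"
      by (simp add: linear_subspace_image)
    obtain a b where ab: "a \<in> span (range ((*v) W))" "\<And>w. w \<in> span (range ((*v) W)) \<Longrightarrow> orthogonal b w"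
      "y = a + b"
      using orthogonal_subspace_decomp_exists[of "range ((*v) W)" y] by metis
    from ab(1) sub obtain x where x: "a = W *v x"
      by (auto simp: span_eq_iff[THEN iffD2])
    have "(transpose W *v b) \<bullet> z = 0" for z
    proof -
      have "orthogonal b (W *v z)" by (intro ab(2) span_base) auto
      then show ?thesis by (simp add: orthogonal_def dot_lmul_matrix)
    qed
    then have "transpose W *v b = 0" using inner_eq_zero_iff by blast
    then show ?thesis
      by (intro exI[of _ x]) (simp only: ab(3) x matrix_vector_right_distrib add_0_right)
  qed
  then obtain h where h: "\<And>y. transpose W *v (W *v h y) = transpose W *v y" by metis
  define K where "K = (\<chi> i j. h (column j Y) $ i)"
  have "column j K = h (column j Y)" for j by (simp add: K_def column_def)
  then have "column j (transpose W ** (W ** K)) = column j (transpose W ** Y)" for j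
    using h by (simp only: column_matrix_mult)
  then show ?thesis
    by (intro exI[of _ K]) (simp add: vec_eq_iff column_def matrix_mul_assoc)
qed


text \<open>
  Let \<open>P\<close> be the orthogonal projection onto the range of \<open>W\<close>, so that \<open>P Y = W K\<close>. As \<open>W\<^sup>T P = W\<^sup>T\<close>,
  the matrix whose norm is computed is \<open>(W W\<^sup>T - Y Y\<^sup>T) P\<close>, and \<open>W\<^sup>T Y K\<close> is the Gram matrix of \<open>P Y\<close>.
\<close>
lemma residual_norm_formula:
  fixes W Y :: "real^'r^'n"
  assumes sym: "transpose (transpose W ** Y) = transpose W ** Y"
    and K: "transpose W ** W ** K = transpose W ** Y"
  shows "(norm ((W - Y ** transpose K) ** transpose W))\<^sup>2
    = (norm (transpose W ** W))\<^sup>2 - 2 * (norm (transpose W ** Y))\<^sup>2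
      + (transpose Y ** Y) \<bullet> (transpose W ** Y ** K)"
    and "transpose K ** (transpose W ** Y) = transpose W ** Y ** K"
    and "transpose K ** (transpose W ** W) = transpose W ** Y"
proof -
  define A where "A = transpose W ** W"
  define B where "B = transpose Y ** Y"
  define S where "S = transpose W ** Y"
  have At: "transpose A = A" by (simp add: A_def matrix_transpose_mul)
  have St: "transpose S = S" using sym by (simp add: S_def)
  have YW: "transpose Y ** W = S" using sym by (simp add: S_def matrix_transpose_mul)
  have AK: "A ** K = S" using K by (simp add: A_def S_def)
  have KA: "transpose K ** A = S" using arg_cong[OF AK, of transpose] by (simp add: matrix_transpose_mul At St)
  then show "transpose K ** (transpose W ** W) = transpose W ** Y" by (simp add: A_def S_def)
  have KS: "transpose K ** S = S ** K"
    by (metis AK KA matrix_mul_assoc)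
  then show "transpose K ** (transpose W ** Y) = transpose W ** Y ** K" by (simp add: S_def)
  have "transpose (W - Y ** transpose K) ** (W - Y ** transpose K)
      = A - S ** transpose K - K ** S + K ** B ** transpose K"
  proof -
    have "transpose (W - Y ** transpose K) ** (W - Y ** transpose K)
      = A - transpose W ** (Y ** transpose K) - K ** transpose Y ** W
        + K ** transpose Y ** (Y ** transpose K)"
      by (simp add: matrix_mult_distribs transpose_distribs matrix_transpose_mul A_def)
    moreover have "transpose W ** (Y ** transpose K) = S ** transpose K"
      by (simp add: S_def matrix_mul_assoc)
    moreover have "K ** transpose Y ** W = K ** S"
      by (simp add: YW flip: matrix_mul_assoc)
    moreover have "K ** transpose Y ** (Y ** transpose K) = K ** B ** transpose K"
      by (simp add: B_def matrix_mul_assoc)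
    ultimately show ?thesis by simp
  qed
  then have "(norm ((W - Y ** transpose K) ** transpose W))\<^sup>2
     = A \<bullet> A - (S ** transpose K) \<bullet> A - (K ** S) \<bullet> A + (K ** B ** transpose K) \<bullet> A"
    by (simp add: norm_matrix_mult_transpose A_def[symmetric] inner_diff_left inner_add_left)
  also have "(S ** transpose K) \<bullet> A = S \<bullet> S"
    by (simp add: inner_matrix_mult_left AK)
  also have "(K ** S) \<bullet> A = S \<bullet> S"
    by (simp add: inner_matrix_mult_right KA)
  also have "(K ** B ** transpose K) \<bullet> A = B \<bullet> (S ** K)"
    by (simp add: inner_matrix_mult_left[of "K ** B"] AK inner_matrix_mult_right[of K B] KS)
  finally show "(norm ((W - Y ** transpose K) ** transpose W))\<^sup>2
    = (norm (transpose W ** W))\<^sup>2 - 2 * (norm (transpose W ** Y))\<^sup>2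
      + (transpose Y ** Y) \<bullet> (transpose W ** Y ** K)"
    by (simp add: power2_norm_eq_inner A_def B_def S_def)
qed

lemma norm_transpose: "norm (transpose A) = norm (A :: real^'n^'m)"
  by (simp add: norm_eq_sqrt_inner inner_transpose)

text \<open>
  Split \<open>Y = W K + (Y - W K)\<close> into its parts inside and orthogonal to the range of \<open>W\<close>, with Gram
  matrices \<open>P\<close> and \<open>N\<close>. The inner part has the same product \<open>W\<^sup>T Y\<close> with \<open>W\<close>, and
  \<open>gram_difference_lower_bound\<close> applies to it. The orthogonal part contributes \<open>N\<bullet>A\<close> with \<open>A = W\<^sup>T W\<close>,
  which equals \<open>N\<bullet>(A - P) + N\<bullet>P\<close>. Here the factor \<open>N\<close>, the only quantity that the projected
  difference of Gram matrices does not control, receives the small weight \<open>1/8\<close> by Young's inequality.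
\<close>
lemma difference_times_factor_bound:
  fixes W Y :: "real^'r^'n"
  assumes sym: "transpose (transpose W ** Y) = transpose W ** Y"
    and psd: "\<And>x. 0 \<le> x \<bullet> ((transpose W ** Y) *v x)"
    and K: "transpose W ** W ** K = transpose W ** Y"
  shows "(norm ((W - Y) ** transpose W))\<^sup>2
    \<le> 1/8 * (norm (W ** transpose W - Y ** transpose Y))\<^sup>2
      + 7/2 * (norm ((W - Y ** transpose K) ** transpose W))\<^sup>2"
proof -
  define A where "A = transpose W ** W"
  define B where "B = transpose Y ** Y"
  define S where "S = transpose W ** Y"
  define P where "P = S ** K"
  define N where "N = B - P"
  have AK: "A ** K = S" using K by (simp add: A_def S_def)
  have KA: "transpose K ** A = S"
    using residual_norm_formula(3)[OF sym K] by (simp add: A_def S_def)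
  have KS: "transpose K ** S = P"
    using residual_norm_formula(2)[OF sym K] by (simp add: S_def P_def)
  have e: "(norm ((W - Y ** transpose K) ** transpose W))\<^sup>2 = A \<bullet> A - 2 * (S \<bullet> S) + B \<bullet> P"
    using residual_norm_formula(1)[OF sym K]
    by (simp add: A_def B_def S_def P_def power2_norm_eq_inner)
  have WWK: "transpose W ** (W ** K) = S" using AK by (simp add: A_def matrix_mul_assoc)
  have WKW: "transpose (W ** K) ** W = S"
    using KA by (simp add: A_def matrix_transpose_mul matrix_mul_assoc)
  have gramP: "transpose (W ** K) ** (W ** K) = P"
    by (simp add: matrix_mul_assoc WKW P_def)
  have YWK: "transpose Y ** (W ** K) = P"
    using sym by (simp add: matrix_mul_assoc P_def S_def matrix_transpose_mul)
  have WKY: "transpose (W ** K) ** Y = P"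
    using KS by (simp add: S_def matrix_transpose_mul matrix_mul_assoc)
  have gramN: "transpose (Y - W ** K) ** (Y - W ** K) = N"
    by (simp add: transpose_distribs matrix_mult_distribs gramP YWK WKY N_def B_def)
  have NP: "0 \<le> N \<bullet> P"
    using norm_matrix_mult_transpose[of "Y - W ** K" "W ** K"] by (metis gramN gramP zero_le_power2)
  have SS: "S \<bullet> S \<le> A \<bullet> P"
  proof -
    have "S \<bullet> S = (W ** transpose (W ** K)) \<bullet> ((W ** K) ** transpose W)"
      by (simp only: inner_outer_products WWK WKW)
    also have "\<dots> \<le> norm (W ** transpose (W ** K)) * norm ((W ** K) ** transpose W)"
      by (rule norm_cauchy_schwarz)
    also have "norm ((W ** K) ** transpose W) = norm (W ** transpose (W ** K))"
      using norm_transpose[of "(W ** K) ** transpose W"]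
      by (simp only: matrix_transpose_mul[of "W ** K"] transpose_transpose)
    also have "norm (W ** transpose (W ** K)) * norm (W ** transpose (W ** K)) = A \<bullet> P"
      using norm_matrix_mult_transpose[of W "W ** K"] by (simp only: A_def gramP power2_eq_square)
    finally show ?thesis .
  qed
  have core: "2/3 * ((A + P - 2 *\<^sub>R S) \<bullet> A) \<le> A \<bullet> A + P \<bullet> P - 2 * (S \<bullet> S)"
  proof -
    have sym': "transpose (transpose W ** (W ** K)) = transpose W ** (W ** K)"
      using sym by (simp only: WWK S_def)
    have psd': "\<And>x. 0 \<le> x \<bullet> ((transpose W ** (W ** K)) *v x)"
      using psd by (simp only: WWK S_def)
    show ?thesis
      using gram_difference_lower_bound[OF sym' psd']
      unfolding norm_gram_difference norm_matrix_mult_transpose gram_diff[OF sym'] gramP WWK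
      by (simp add: A_def power2_norm_eq_inner)
  qed
  (* Young's inequality with weights 1/8 and 2 *)
  have "0 \<le> (N - 4 *\<^sub>R (A - P)) \<bullet> (N - 4 *\<^sub>R (A - P))" by simp
  then have young: "0 \<le> N \<bullet> N - 8 * (N \<bullet> A - N \<bullet> P) + 16 * (A \<bullet> A + P \<bullet> P - 2 * (A \<bullet> P))"
    by (simp add: inner_diff_left inner_diff_right inner_commute[of A N] inner_commute[of P N]
        inner_commute[of P A])
  have "0 \<le> (A - P) \<bullet> (A - P)" by simp
  then have AP: "2 * (A \<bullet> P) \<le> A \<bullet> A + P \<bullet> P"
    by (simp add: inner_diff_left inner_diff_right inner_commute[of P A])
  have lhs: "(norm ((W - Y) ** transpose W))\<^sup>2 = (A + P - 2 *\<^sub>R S) \<bullet> A + N \<bullet> A"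
    unfolding norm_matrix_mult_transpose gram_diff[OF sym]
    by (simp add: A_def B_def S_def N_def inner_add_left inner_diff_left)
  have gap: "(norm (W ** transpose W - Y ** transpose Y))\<^sup>2
      = A \<bullet> A + P \<bullet> P + 2 * (N \<bullet> P) + N \<bullet> N - 2 * (S \<bullet> S)"
  proof -
    have "B \<bullet> B = P \<bullet> P + 2 * (N \<bullet> P) + N \<bullet> N"
      by (simp add: N_def inner_diff_left inner_diff_right inner_commute[of P B])
    then show ?thesis
      unfolding norm_gram_difference by (simp add: A_def B_def S_def power2_norm_eq_inner)
  qed
  have e': "(norm ((W - Y ** transpose K) ** transpose W))\<^sup>2
      = A \<bullet> A - 2 * (S \<bullet> S) + P \<bullet> P + N \<bullet> P"
    by (simp add: e N_def inner_diff_left)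
  show ?thesis
    unfolding lhs gap e' using core young SS NP AP
    unfolding inner_add_left inner_diff_left inner_scaleR_left inner_commute[of P A] by argo
qed

section \<open>Balanced stacked factors\<close>

lemma sum_UNIV_sum_type:
  "(\<Sum>i\<in>(UNIV :: ('p::finite + 'q::finite) set). h i) = (\<Sum>a\<in>UNIV. h (Inl a)) + (\<Sum>b\<in>UNIV. h (Inr b))"
  by (simp add: UNIV_Plus_UNIV[symmetric] sum.Plus del: UNIV_Plus_UNIV)

lemma stack_gram: "transpose (stack U V) ** stack U' V' = transpose U ** U' + transpose V ** V'"
  by (simp add: vec_eq_iff matrix_matrix_mult_def transpose_def stack_def sum_UNIV_sum_type)

lemma inner_stack: "stack U V \<bullet> stack U' V' = U \<bullet> U' + V \<bullet> V'"
  by (simp add: inner_vec_def stack_def sum_UNIV_sum_type)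

lemma stack_mult: "stack U V ** K = stack (U ** K) (V ** K)"
  by (auto simp: vec_eq_iff stack_def matrix_matrix_mult_def split: sum.split)

text \<open>
  Balancedness turns both sides into expressions in \<open>U\<^sup>T U\<close>, \<open>U'\<^sup>T U'\<close>, \<open>C = U\<^sup>T U'\<close> and \<open>D = V\<^sup>T V'\<close>.
  Their difference is \<open>2 \<parallel>C - D\<parallel>\<^sup>2\<close>.
\<close>
lemma stacked_difference_le_product_difference:
  fixes U U' :: "real^'r^'p" and V V' :: "real^'r^'q"
  assumes bal: "transpose U ** U = transpose V ** V" and bal': "transpose U' ** U' = transpose V' ** V'"
  defines "W \<equiv> stack U V" and "Y \<equiv> stack U' V'"
  shows "(norm (W ** transpose W - Y ** transpose Y))\<^sup>2
    \<le> 4 * (norm (U ** transpose V - U' ** transpose V'))\<^sup>2"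
proof -
  define a where "a = transpose U ** U"
  define b where "b = transpose U' ** U'"
  define C where "C = transpose U ** U'"
  define D where "D = transpose V ** V'"
  have "(norm (U ** transpose V - U' ** transpose V'))\<^sup>2 = a \<bullet> a + b \<bullet> b - 2 * (C \<bullet> D)"
  proof -
    have "(U' ** transpose V') \<bullet> (U ** transpose V) = (U ** transpose V) \<bullet> (U' ** transpose V')"
      by (rule inner_commute)
    then show ?thesis
      by (simp add: power2_norm_eq_inner inner_diff_left inner_diff_right inner_outer_products
          a_def b_def C_def D_def flip: bal bal')
  qed
  moreover have "(norm (W ** transpose W - Y ** transpose Y))\<^sup>2
      = (2 *\<^sub>R a) \<bullet> (2 *\<^sub>R a) + (2 *\<^sub>R b) \<bullet> (2 *\<^sub>R b) - 2 * ((C + D) \<bullet> (C + D))"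
    unfolding norm_gram_difference W_def Y_def stack_gram
    by (simp add: power2_norm_eq_inner a_def b_def C_def D_def scaleR_2 flip: bal bal')
  moreover have "0 \<le> (C - D) \<bullet> (C - D)" by simp
  ultimately show ?thesis
    by (simp add: inner_diff_left inner_diff_right inner_add_left inner_add_right inner_commute[of D C])
qed

lemma product_derivative_norm_le:
  fixes U D :: "real^'r^'p" and V D' :: "real^'r^'q"
  assumes bal: "transpose U ** U = transpose V ** V"
  shows "(norm (D ** transpose V + U ** transpose D'))\<^sup>2
    \<le> (norm (stack D D' ** transpose (stack U V)))\<^sup>2"
proof -
  define a where "a = transpose U ** U"
  have "(norm (stack D D' ** transpose (stack U V)))\<^sup>2
      = 2 * ((transpose D ** D) \<bullet> a + (transpose D' ** D') \<bullet> a)"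
    unfolding norm_matrix_mult_transpose stack_gram bal[symmetric] a_def[symmetric]
      inner_add_left inner_add_right by simp
  moreover have "(norm (D ** transpose V))\<^sup>2 = (transpose D ** D) \<bullet> a"
    by (simp add: norm_matrix_mult_transpose a_def bal)
  moreover have "(norm (U ** transpose D'))\<^sup>2 = (transpose D' ** D') \<bullet> a"
    unfolding norm_matrix_mult_transpose by (simp add: inner_commute a_def)
  moreover have "(norm (x + y))\<^sup>2 \<le> 2 * ((norm x)\<^sup>2 + (norm y)\<^sup>2)" for x y :: "real^'q^'p"
  proof -
    have "0 \<le> (x - y) \<bullet> (x - y)" by simp
    then show ?thesis
      by (simp add: power2_norm_eq_inner inner_add_left inner_add_right inner_diff_left
          inner_diff_right inner_commute[of y x])
  qed
  ultimately show ?thesis by metis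
qed

text \<open>
  Up to the factor \<open>1/2\<close>, the projected residual is controlled by an inner product that involves
  only the difference of the two products. Both sides reduce to Gram matrices; with \<open>C = U\<^sup>T U'\<close> and
  \<open>D = V\<^sup>T V'\<close> they differ by \<open>1/2 \<parallel>C - D\<parallel>\<^sup>2\<close>.
\<close>
lemma residual_norm_le_inner:
  fixes U U' :: "real^'r^'p" and V V' :: "real^'r^'q"
  assumes bal: "transpose U ** U = transpose V ** V" and bal': "transpose U' ** U' = transpose V' ** V'"
  defines "W \<equiv> stack U V" and "Y \<equiv> stack U' V'"
  assumes sym: "transpose (transpose W ** Y) = transpose W ** Y"
    and K: "transpose W ** W ** K = transpose W ** Y"
  shows "1/2 * (norm ((W - Y ** transpose K) ** transpose W))\<^sup>2
    \<le> (U ** transpose V - U' ** transpose V') \<bullet>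
       ((U - U' ** transpose K) ** transpose V + U ** transpose (V - V' ** transpose K))"
proof -
  define a where "a = transpose U ** U"
  define b where "b = transpose U' ** U'"
  define C where "C = transpose U ** U'"
  define D where "D = transpose V ** V'"
  have A: "transpose W ** W = 2 *\<^sub>R a" unfolding W_def stack_gram by (simp add: a_def scaleR_2 flip: bal)
  have B: "transpose Y ** Y = 2 *\<^sub>R b" unfolding Y_def stack_gram by (simp add: b_def scaleR_2 flip: bal')
  have S: "transpose W ** Y = C + D" unfolding W_def Y_def stack_gram by (simp add: C_def D_def)
  have St: "transpose (C + D) = C + D" using sym by (simp only: S)
  have Ct: "transpose U' ** U = transpose C" and Dt: "transpose V' ** V = transpose D"
    by (simp_all add: C_def D_def matrix_transpose_mul)
  have aK: "a ** K = (1/2) *\<^sub>R (C + D)"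
    using arg_cong[OF K, of "\<lambda>X. (1/2) *\<^sub>R X"] by (simp add: A S matrix_mult_distribs)
  have e: "(norm ((W - Y ** transpose K) ** transpose W))\<^sup>2
      = 4 * (a \<bullet> a) - 2 * ((C + D) \<bullet> (C + D)) + 2 * (b \<bullet> ((C + D) ** K))"
    using residual_norm_formula(1)[OF sym K] by (simp add: A B S power2_norm_eq_inner)
  have "(U ** transpose V) \<bullet> ((U - U' ** transpose K) ** transpose V)
      = (a - C ** transpose K) \<bullet> a"
    unfolding inner_outer_products
    by (simp add: matrix_mult_distribs matrix_mul_assoc a_def C_def flip: bal)
  moreover have "(U ** transpose V) \<bullet> (U ** transpose (V - V' ** transpose K))
      = a \<bullet> (a - D ** transpose K)"
    unfolding inner_outer_products
    by (simp add: matrix_mult_distribs matrix_mul_assoc a_def D_def flip: bal)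
  moreover have "(U' ** transpose V') \<bullet> ((U - U' ** transpose K) ** transpose V)
      = (transpose C - b ** transpose K) \<bullet> transpose D"
    unfolding inner_outer_products
    by (simp add: matrix_mult_distribs matrix_mul_assoc b_def Ct Dt)
  moreover have "(U' ** transpose V') \<bullet> (U ** transpose (V - V' ** transpose K))
      = transpose C \<bullet> (transpose D - b ** transpose K)"
    unfolding inner_outer_products
    by (simp add: matrix_mult_distribs matrix_mul_assoc b_def Ct Dt flip: bal')
  moreover have "(X - X') \<bullet> (L + L') = X \<bullet> L + X \<bullet> L' - X' \<bullet> L - X' \<bullet> L'" for X X' L L' :: "real^'q^'p"
    by (simp add: inner_diff_left inner_add_right)
  ultimately have "(U ** transpose V - U' ** transpose V') \<bullet>
       ((U - U' ** transpose K) ** transpose V + U ** transpose (V - V' ** transpose K))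
     = (a - C ** transpose K) \<bullet> a + a \<bullet> (a - D ** transpose K)
       - (transpose C - b ** transpose K) \<bullet> transpose D - transpose C \<bullet> (transpose D - b ** transpose K)"
    by metis
  also have "\<dots> = 2 * (a \<bullet> a) - ((C + D) ** transpose K) \<bullet> a - 2 * (transpose C \<bullet> transpose D)
       + (b ** transpose K) \<bullet> transpose (C + D)"
    by (simp add: inner_diff_left inner_diff_right inner_add_right inner_add_left
        transpose_distribs matrix_mult_distribs inner_commute[of a "D ** transpose K"]
        inner_commute[of "transpose C" "b ** transpose K"])
  also have "((C + D) ** transpose K) \<bullet> a = 1/2 * ((C + D) \<bullet> (C + D))"
    by (simp add: inner_matrix_mult_left aK)
  also have "(b ** transpose K) \<bullet> transpose (C + D) = b \<bullet> ((C + D) ** K)"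
    by (simp only: St inner_matrix_mult_left transpose_transpose)
  finally have H: "(U ** transpose V - U' ** transpose V') \<bullet>
       ((U - U' ** transpose K) ** transpose V + U ** transpose (V - V' ** transpose K))
     = 2 * (a \<bullet> a) - 1/2 * ((C + D) \<bullet> (C + D)) - 2 * (C \<bullet> D) + b \<bullet> ((C + D) ** K)"
    by (simp only: inner_transpose)
  have "0 \<le> (C - D) \<bullet> (C - D)" by simp
  then have "4 * (C \<bullet> D) \<le> (C + D) \<bullet> (C + D)"
    by (simp add: inner_diff_left inner_diff_right inner_add_left inner_add_right inner_commute[of D C])
  then show ?thesis unfolding H e by simp
qed

section \<open>Orthonormal eigenbases of symmetric matrices\<close>

definition outer :: "real^'m \<Rightarrow> real^'n \<Rightarrow> real^'n^'m" where
  "outer u v = (\<chi> i j. u $ i * v $ j)"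

lemma outer_mult_vector: "outer u v *v x = (v \<bullet> x) *\<^sub>R u"
  by (simp add: outer_def vec_eq_iff matrix_vector_mult_def inner_vec_def sum_distrib_left sum_distrib_right mult_ac)

lemma transpose_outer: "transpose (outer u v) = outer v u"
  by (simp add: outer_def transpose_def vec_eq_iff mult.commute)

lemma inner_outer: "X \<bullet> outer u v = u \<bullet> (X *v v)"
  by (simp add: outer_def inner_vec_def matrix_vector_mult_def sum_distrib_left mult_ac)

lemma outer_mult_outer: "outer u v ** outer x y = (v \<bullet> x) *\<^sub>R outer u y"
  by (simp add: outer_def vec_eq_iff matrix_matrix_mult_def inner_vec_def sum_distrib_left sum_distrib_right mult_ac)

lemma linear_mult_vector: "linear (\<lambda>M::real^'n^'m. M *v x)"
  by (auto intro!: linearI simp: matrix_vector_mult_add_rdistrib scaleR_matrix_vector_assoc)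

lemmas sum_mult_vector = linear_sum[OF linear_mult_vector]

lemma symmetric_form_commute:
  fixes A :: "real^'n^'n"
  assumes "transpose A = A"
  shows "x \<bullet> (A *v y) = y \<bullet> (A *v x)"
  using symmetric_inner_matrix[OF assms, of x y] by (simp add: inner_commute)

definition orthonormal_basis :: "(real^'n) set \<Rightarrow> bool" where
  "orthonormal_basis B \<longleftrightarrow>
     finite B \<and> pairwise orthogonal B \<and> (\<forall>b\<in>B. norm b = 1) \<and> span B = UNIV"

lemma orthonormal_inner:
  assumes "orthonormal_basis B" "b \<in> B" "c \<in> B"
  shows "b \<bullet> c = (if b = c then 1 else 0)"
  using assms unfolding orthonormal_basis_def pairwise_def orthogonal_def by (auto simp: norm_eq_1)

lemma orthonormal_expand:
  assumes "orthonormal_basis B"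
  shows "(\<Sum>b\<in>B. (x \<bullet> b) *\<^sub>R b) = x"
  using assms unfolding orthonormal_basis_def by (intro orthonormal_basis_expand) auto

lemma parseval:
  assumes "orthonormal_basis B"
  shows "x \<bullet> y = (\<Sum>b\<in>B. (x \<bullet> b) * (y \<bullet> b))"
proof -
  have "x \<bullet> y = x \<bullet> (\<Sum>b\<in>B. (y \<bullet> b) *\<^sub>R b)" by (simp add: orthonormal_expand[OF assms])
  then show ?thesis by (simp add: inner_sum_right mult.commute)
qed

lemma parseval_norm:
  assumes "orthonormal_basis B"
  shows "(norm x)\<^sup>2 = (\<Sum>b\<in>B. (x \<bullet> b)\<^sup>2)"
  using parseval[OF assms, of x x] by (simp add: power2_norm_eq_inner) (simp add: power2_eq_square)

lemma frobenius_orthonormal: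
  fixes M N :: "real^'n^'m"
  assumes "orthonormal_basis B"
  shows "M \<bullet> N = (\<Sum>b\<in>B. (M *v b) \<bullet> (N *v b))"
proof -
  have "M \<bullet> N = (\<Sum>i\<in>UNIV. \<Sum>b\<in>B. (M $ i \<bullet> b) * (N $ i \<bullet> b))"
    by (simp add: inner_vec_def[of M] parseval[OF assms, symmetric])
  also have "\<dots> = (\<Sum>b\<in>B. \<Sum>i\<in>UNIV. (M $ i \<bullet> b) * (N $ i \<bullet> b))"
    by (rule sum.swap)
  also have "\<dots> = (\<Sum>b\<in>B. (M *v b) \<bullet> (N *v b))"
    by (simp add: inner_vec_def[of "_ *v _"] matrix_vector_mul_component)
  finally show ?thesis .
qed

definition eigenbasis :: "real^'n^'n \<Rightarrow> (real^'n) set \<Rightarrow> bool" where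
  "eigenbasis A B \<longleftrightarrow> orthonormal_basis B \<and> (\<forall>b\<in>B. A *v b = (b \<bullet> (A *v b)) *\<^sub>R b)"

text \<open>
  Take an orthonormal system \<open>B\<close> of eigenvectors of maximal size. If it does not span, subtract
  \<open>c b b\<^sup>T\<close> from \<open>A\<close> for all \<open>b \<in> B\<close>, with \<open>c\<close> so large that the elements of \<open>B\<close> no longer belong to the
  largest eigenvalue. An eigenvector for the largest eigenvalue of the new matrix is then orthogonal
  to \<open>B\<close>, so it is also an eigenvector of \<open>A\<close>, and \<open>B\<close> was not maximal.
\<close>
theorem eigenbasis_exists:
  fixes A :: "real^'n^'n"
  assumes sym: "transpose A = A"
  obtains B where "eigenbasis A B"
proof -
  define good where "good B \<longleftrightarrow> finite B \<and> pairwise orthogonal B \<and> (\<forall>b\<in>B. norm b = 1)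
      \<and> (\<forall>b\<in>B. A *v b = (b \<bullet> (A *v b)) *\<^sub>R b)" for B
  have card_le: "card B \<le> CARD('n)" if "good B" for B
  proof -
    have "independent B"
      using that by (intro pairwise_orthogonal_independent) (auto simp: good_def)
    then show ?thesis using independent_card_le[of B] by simp
  qed
  have "good {}" by (simp add: good_def)
  then obtain B where B: "good B" and max: "\<And>C. good C \<Longrightarrow> card C \<le> card B"
    using ex_has_greatest_nat[of good "{}" card "Suc CARD('n)"] card_le le_imp_less_Suc by metis
  have "span B = UNIV"
  proof (rule ccontr)
    assume "span B \<noteq> UNIV"
    then obtain w where w: "w \<noteq> 0" "\<And>x. x \<in> span B \<Longrightarrow> w \<bullet> x = 0"
      using span_not_UNIV_orthogonal by blast
    define l where "l b = b \<bullet> (A *v b)" for b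
    (* \<kappa> is a value of the Rayleigh quotient on the complement of B, so it bounds the largest
       eigenvalue of the deflated matrix from below. *)
    define \<kappa> where "\<kappa> = w \<bullet> (A *v w) / (w \<bullet> w)"
    define c where "c = 1 + (\<Sum>b\<in>B. \<bar>l b\<bar>) - \<kappa>"
    have c: "l b - c < \<kappa>" if "b \<in> B" for b
      using member_le_sum[of b B "\<lambda>b. \<bar>l b\<bar>"] that B by (auto simp: c_def good_def)
    define A' where "A' = A - c *\<^sub>R (\<Sum>b\<in>B. outer b b)"
    have A': "A' *v x = A *v x - c *\<^sub>R (\<Sum>b\<in>B. (b \<bullet> x) *\<^sub>R b)" for x
      by (simp add: A'_def matrix_vector_mult_diff_rdistrib sum_mult_vector outer_mult_vector
          flip: scaleR_matrix_vector_assoc)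
    have sym': "transpose A' = A'"
      by (simp add: A'_def transpose_distribs linear_sum[OF linear_transpose] transpose_outer sym)
    obtain \<mu> v where v: "v \<noteq> 0" "A' *v v = \<mu> *\<^sub>R v" and \<mu>: "\<And>x. x \<bullet> (A' *v x) \<le> \<mu> * (x \<bullet> x)"
      using ex_max_eigenvalue[OF sym'] unfolding eigenvalue_def by blast
    have "w \<bullet> (A' *v w) = w \<bullet> (A *v w)"
      using w(2) by (simp add: A' inner_diff_right inner_sum_right span_base inner_commute)
    then have "\<kappa> \<le> \<mu>"
      using \<mu>[of w] w(1) by (simp add: \<kappa>_def divide_simps)
    have vb: "b \<bullet> v = 0" if "b \<in> B" for b
    proof -
      have "(\<Sum>d\<in>B. (d \<bullet> b) *\<^sub>R d) = (\<Sum>d\<in>B. if d = b then b else 0)"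
        using B that by (intro sum.cong) (auto simp: good_def pairwise_def orthogonal_def norm_eq_1)
      also have "\<dots> = b" using B that by (simp add: good_def)
      finally have "A' *v b = (l b - c) *\<^sub>R b"
        using B that by (simp add: A' good_def l_def scaleR_diff_left)
      then have "\<mu> * (b \<bullet> v) = (l b - c) * (b \<bullet> v)"
        using symmetric_form_commute[OF sym', of b v] by (simp add: v(2) inner_commute)
      with c[OF that] \<open>\<kappa> \<le> \<mu>\<close> show ?thesis by auto
    qed
    then have Av: "A *v v = \<mu> *\<^sub>R v" using v(2) by (simp add: A')
    define u where "u = v /\<^sub>R norm v"
    have nu: "norm u = 1" using v(1) by (simp add: u_def)
    have Au: "A *v u = \<mu> *\<^sub>R u" by (simp add: u_def matrix_vector_mult_scaleR Av)
    have ub: "b \<bullet> u = 0" if "b \<in> B" for b using vb[OF that] by (simp add: u_def)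
    have "good (insert u B)"
      using B nu Au ub unfolding good_def
      by (auto simp: pairwise_insert orthogonal_def inner_commute norm_eq_1)
    moreover have "u \<notin> B" using ub nu by (auto simp: norm_eq_1)
    ultimately show False using max[of "insert u B"] B by (simp add: good_def)
  qed
  with B show thesis
    by (intro that[of B]) (auto simp: good_def eigenbasis_def orthonormal_basis_def)
qed

lemma eigenbasis_form:
  assumes B: "eigenbasis A B" and sym: "transpose A = A"
  shows "x \<bullet> (A *v y) = (\<Sum>b\<in>B. (b \<bullet> (A *v b)) * ((x \<bullet> b) * (y \<bullet> b)))"
proof -
  have "(A *v y) \<bullet> b = (b \<bullet> (A *v b)) * (y \<bullet> b)" if "b \<in> B" for b
  proof -
    have "(A *v y) \<bullet> b = y \<bullet> (A *v b)" by (rule symmetric_inner_matrix[OF sym])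
    also have "\<dots> = y \<bullet> ((b \<bullet> (A *v b)) *\<^sub>R b)" using B that by (simp add: eigenbasis_def)
    finally show ?thesis by simp
  qed
  then show ?thesis
    using B by (simp add: parseval[of B x] eigenbasis_def mult_ac cong: sum.cong)
qed

lemma eigenvalue_eigenbasis:
  assumes B: "eigenbasis A B" and sym: "transpose A = A" and "b \<in> B"
  shows "eigenvalue A (b \<bullet> (A *v b))"
  using assms unfolding eigenvalue_def eigenbasis_def orthonormal_basis_def
  by (intro exI[of _ b]) auto

lemma lambda_min_le_form:
  fixes A :: "real^'n^'n"
  assumes sym: "transpose A = A"
  shows "lambda_min A * (x \<bullet> x) \<le> x \<bullet> (A *v x)"
proof -
  obtain B where B: "eigenbasis A B" using eigenbasis_exists[OF sym] .
  have "lambda_min A \<le> b \<bullet> (A *v b)" if "b \<in> B" for b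
    unfolding lambda_min_def
    using eigenvalue_eigenbasis[OF B sym that] finite_eigenvalues[OF sym] by simp
  then have "lambda_min A * (\<Sum>b\<in>B. (x \<bullet> b) * (x \<bullet> b)) \<le> (\<Sum>b\<in>B. (b \<bullet> (A *v b)) * ((x \<bullet> b) * (x \<bullet> b)))"
    unfolding sum_distrib_left by (intro sum_mono mult_right_mono) auto
  then show ?thesis
    using B by (simp add: eigenbasis_form[OF B sym, of x x] parseval[of B x x] eigenbasis_def)
qed

lemma eigenvalue_lambda_min:
  assumes "transpose A = A"
  shows "eigenvalue A (lambda_min A)"
  using Min_in[OF finite_eigenvalues[OF assms]] ex_max_eigenvalue[OF assms]
  unfolding lambda_min_def by blast

lemma gram_form:
  fixes X :: "real^'n^'m" and Y :: "real^'k^'m"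
  shows "x \<bullet> ((transpose X ** Y) *v y) = (X *v x) \<bullet> (Y *v y)"
  by (metis dot_lmul_matrix inner_commute matrix_vector_mul_assoc vector_transpose_matrix)

section \<open>The smallest nonzero singular value and the distance of factors\<close>

lemma rho_le_norm_eigenvector:
  fixes X :: "real^'n^'m"
  assumes B: "eigenbasis (transpose X ** X) B" and "b \<in> B" and "X *v b \<noteq> 0"
  shows "rho X \<le> norm (X *v b)"
proof -
  have "eigenvalue (transpose X ** X) ((norm (X *v b))\<^sup>2)"
    using eigenvalue_eigenbasis[OF B symmetric_gram \<open>b \<in> B\<close>]
    by (simp add: gram_form power2_norm_eq_inner)
  then have "norm (X *v b) \<in> {s. singular_value X s \<and> s \<noteq> 0}"
    using assms(3) by (simp add: singular_value_def)
  moreover have "finite {s. singular_value X s \<and> s \<noteq> 0}"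
    using finite_singular_values[of X] by (rule rev_finite_subset) auto
  moreover have "X \<noteq> 0" using assms(3) by auto
  ultimately show ?thesis by (simp add: rho_def)
qed

lemma rho_nonneg: "0 \<le> rho X"
proof (cases "X = 0")
  case False
  have "finite {s. singular_value X s \<and> s \<noteq> 0}"
    using finite_singular_values[of X] by (rule rev_finite_subset) auto
  then have "Min {s. singular_value X s \<and> s \<noteq> 0} \<in> {s. singular_value X s \<and> s \<noteq> 0}"
    using ex_nonzero_singular_value[OF False] by (intro Min_in) auto
  then show ?thesis using False by (simp add: rho_def singular_value_def)
qed (simp add: rho_def)

lemma rho_gram_bound:
  fixes X :: "real^'n^'m"
  shows "(rho X)\<^sup>2 * (norm (X *v x))\<^sup>2 \<le> (norm ((transpose X ** X) *v x))\<^sup>2"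
proof -
  define A where "A = transpose X ** X"
  have sym: "transpose A = A" by (simp add: A_def matrix_transpose_mul)
  obtain B where B: "eigenbasis A B" using eigenbasis_exists[OF sym] .
  have on: "orthonormal_basis B" using B by (simp add: eigenbasis_def)
  define l where "l b = (norm (X *v b))\<^sup>2" for b
  have l: "b \<bullet> (A *v b) = l b" for b by (simp add: A_def gram_form l_def power2_norm_eq_inner)
  have "(norm (X *v x))\<^sup>2 = (\<Sum>b\<in>B. l b * (x \<bullet> b)\<^sup>2)"
    using eigenbasis_form[OF B sym, of x x]
    by (simp add: A_def gram_form l_def flip: power2_norm_eq_inner power2_eq_square)
  moreover have "(norm (A *v x))\<^sup>2 = (\<Sum>b\<in>B. (l b * (x \<bullet> b))\<^sup>2)"
  proof -
    have "(A *v x) \<bullet> b = l b * (x \<bullet> b)" if "b \<in> B" for b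
    proof -
      have "(A *v x) \<bullet> b = x \<bullet> (A *v b)" by (rule symmetric_inner_matrix[OF sym])
      also have "A *v b = l b *\<^sub>R b" using B that by (simp add: eigenbasis_def l)
      finally show ?thesis by simp
    qed
    then show ?thesis by (simp add: parseval_norm[OF on] cong: sum.cong)
  qed
  moreover have "(rho X)\<^sup>2 * (l b * (x \<bullet> b)\<^sup>2) \<le> (l b * (x \<bullet> b))\<^sup>2" if "b \<in> B" for b
  proof (cases "X *v b = 0")
    case False
    then have "rho X \<le> norm (X *v b)"
      using rho_le_norm_eigenvector B that by (auto simp: A_def)
    then have "(rho X)\<^sup>2 \<le> l b" unfolding l_def by (intro power_mono rho_nonneg)
    then have "(rho X)\<^sup>2 * (l b * (x \<bullet> b)\<^sup>2) \<le> l b * (l b * (x \<bullet> b)\<^sup>2)"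
      by (intro mult_right_mono) (simp_all add: l_def)
    then show ?thesis by (simp add: power2_eq_square mult_ac)
  qed (simp add: l_def)
  ultimately show ?thesis
    unfolding A_def[symmetric] by (simp add: sum_distrib_left sum_mono)
qed

text \<open>
  If \<open>s \<le> \<alpha>\<close> then \<open>2 \<alpha> s - 2 s\<^sup>2 \<ge> 0\<close> and the linear bounds on \<open>x\<close> and \<open>y\<close> suffice. Otherwise
  \<open>a + b \<ge> 2 s > 2 \<alpha>\<close>, and the quadratic bounds reduce the claim to
  \<open>(a + b - 2 s) ((a + b + 2 s) / 2 - \<alpha>) \<ge> 0\<close>.
\<close>
lemma scalar_gap_bound:
  fixes a b s x y \<alpha> :: real
  assumes "a\<^sup>2 \<le> x" "\<alpha> * a \<le> x" "b\<^sup>2 \<le> y" "\<alpha> * b \<le> y"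
    and "0 \<le> a" "0 \<le> b" "0 \<le> s" "s\<^sup>2 \<le> a * b" "0 \<le> \<alpha>"
  shows "\<alpha> * (a + b - 2 * s) \<le> x + y - 2 * s\<^sup>2"
proof (cases "s \<le> \<alpha>")
  case True
  then have "s * s \<le> \<alpha> * s" using assms by (intro mult_right_mono)
  then show ?thesis using assms by (simp add: power2_eq_square algebra_simps)
next
  case False
  have "(2 * s)\<^sup>2 \<le> (a + b)\<^sup>2"
    using assms(8) zero_le_power2[of "a - b"] unfolding power2_eq_square by (simp add: algebra_simps)
  then have s: "2 * s \<le> a + b" by (rule power2_le_imp_le) (use assms in simp)
  then have "0 \<le> (a + b - 2 * s) * ((a + b + 2 * s) / 2 - \<alpha>)"
    using False assms by (intro mult_nonneg_nonneg) auto
  moreover have "(a + b)\<^sup>2 / 2 \<le> a\<^sup>2 + b\<^sup>2"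
    using zero_le_power2[of "a - b"] by (simp add: power2_eq_square algebra_simps)
  ultimately show ?thesis using assms(1,3) by (simp add: power2_eq_square field_simps)
qed

text \<open>
  Evaluating all Frobenius norms on an orthonormal eigenbasis of \<open>W\<^sup>T Y\<close> reduces the claim to one
  scalar inequality for each basis vector \<open>b\<close>, where \<open>a = \<parallel>W b\<parallel>\<^sup>2\<close>, \<open>s = W b \<bullet> Y b\<close> and \<open>x = \<parallel>W\<^sup>T W b\<parallel>\<^sup>2\<close>
  (likewise for \<open>Y\<close>). The premises on \<open>\<alpha>\<close> say that the nonzero eigenvalues of both Gram matrices are
  at least \<open>\<alpha>\<close>.
\<close>
lemma gram_difference_ge_factor_difference:
  fixes W Y :: "real^'r^'n"
  assumes sym: "transpose (transpose W ** Y) = transpose W ** Y"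
    and psd: "\<And>x. 0 \<le> x \<bullet> ((transpose W ** Y) *v x)"
    and "0 \<le> \<alpha>"
    and W: "\<And>x. \<alpha> * (norm (W *v x))\<^sup>2 \<le> (norm ((transpose W ** W) *v x))\<^sup>2"
    and Y: "\<And>x. \<alpha> * (norm (Y *v x))\<^sup>2 \<le> (norm ((transpose Y ** Y) *v x))\<^sup>2"
  shows "\<alpha> * (norm (W - Y))\<^sup>2 \<le> (norm (W ** transpose W - Y ** transpose Y))\<^sup>2"
proof -
  define A where "A = transpose W ** W"
  define B where "B = transpose Y ** Y"
  define S where "S = transpose W ** Y"
  obtain E where E: "eigenbasis S E" using eigenbasis_exists sym unfolding S_def by blast
  then have on: "orthonormal_basis E" by (simp add: eigenbasis_def)
  have pointwise: "\<alpha> * ((norm (W *v b))\<^sup>2 + (norm (Y *v b))\<^sup>2 - 2 * ((W *v b) \<bullet> (Y *v b)))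
      \<le> (norm (A *v b))\<^sup>2 + (norm (B *v b))\<^sup>2 - 2 * (norm (S *v b))\<^sup>2" if "b \<in> E" for b
  proof -
    have nb: "norm b = 1" using on that by (simp add: orthonormal_basis_def)
    have sq: "(b \<bullet> z)\<^sup>2 \<le> (norm z)\<^sup>2" for z
      using Cauchy_Schwarz_ineq[of b z] nb by (simp add: power2_norm_eq_inner norm_eq_1)
    have "S *v b = ((W *v b) \<bullet> (Y *v b)) *\<^sub>R b"
      using E that by (simp add: eigenbasis_def S_def gram_form)
    then have nS: "(norm (S *v b))\<^sup>2 = ((W *v b) \<bullet> (Y *v b))\<^sup>2" using nb by simp
    show ?thesis
      unfolding nS
    proof (rule scalar_gap_bound)
      show "((norm (W *v b))\<^sup>2)\<^sup>2 \<le> (norm (A *v b))\<^sup>2"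
        using sq[of "A *v b"] by (simp add: A_def gram_form power2_norm_eq_inner)
      show "((norm (Y *v b))\<^sup>2)\<^sup>2 \<le> (norm (B *v b))\<^sup>2"
        using sq[of "B *v b"] by (simp add: B_def gram_form power2_norm_eq_inner)
      show "((W *v b) \<bullet> (Y *v b))\<^sup>2 \<le> (norm (W *v b))\<^sup>2 * (norm (Y *v b))\<^sup>2"
        by (simp add: power2_norm_eq_inner Cauchy_Schwarz_ineq)
      show "0 \<le> (W *v b) \<bullet> (Y *v b)" using psd[of b] by (simp add: gram_form)
    qed (use W Y \<open>0 \<le> \<alpha>\<close> in \<open>auto simp: A_def B_def\<close>)
  qed
  have "(norm (W - Y))\<^sup>2 = W \<bullet> W + Y \<bullet> Y - 2 * (W \<bullet> Y)"
    by (simp add: power2_norm_eq_inner inner_diff_left inner_diff_right inner_commute[of Y W])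
  also have "\<dots> = (\<Sum>b\<in>E. (norm (W *v b))\<^sup>2 + (norm (Y *v b))\<^sup>2 - 2 * ((W *v b) \<bullet> (Y *v b)))"
    by (simp add: frobenius_orthonormal[OF on] sum.distrib sum_subtractf sum_distrib_left power2_norm_eq_inner)
  finally have lhs: "(norm (W - Y))\<^sup>2 = \<dots>" .
  have "(norm (W ** transpose W - Y ** transpose Y))\<^sup>2 = A \<bullet> A + B \<bullet> B - 2 * (S \<bullet> S)"
    unfolding norm_gram_difference by (simp add: A_def B_def S_def power2_norm_eq_inner)
  also have "\<dots> = (\<Sum>b\<in>E. (norm (A *v b))\<^sup>2 + (norm (B *v b))\<^sup>2 - 2 * (norm (S *v b))\<^sup>2)"
    by (simp add: frobenius_orthonormal[OF on] sum.distrib sum_subtractf sum_distrib_left power2_norm_eq_inner)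
  finally show ?thesis
    unfolding lhs using pointwise by (simp add: sum_distrib_left sum_mono)
qed

section \<open>Orthogonal alignment\<close>

lemma compact_orthogonal_matrices: "compact {R :: real^'r^'r. orthogonal_matrix R}"
proof -
  have "norm R = norm (mat 1 :: real^'r^'r)" if R: "orthogonal_matrix R" for R :: "real^'r^'r"
  proof -
    have "R \<bullet> R = (R ** mat 1) \<bullet> R" by simp
    also have "\<dots> = mat 1 \<bullet> (transpose R ** R)" by (rule inner_matrix_mult_right)
    also have "transpose R ** R = mat 1" using R by (simp only: orthogonal_matrix)
    finally show ?thesis by (simp only: norm_eq_sqrt_inner)
  qed
  then have "bounded {R :: real^'r^'r. orthogonal_matrix R}"
    by (intro boundedI[of _ "norm (mat 1 :: real^'r^'r)"]) simp
  moreover have "closed {R :: real^'r^'r. orthogonal_matrix R}"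
    unfolding orthogonal_matrix
    by (intro closed_Collect_eq bounded_bilinear.continuous_on[OF bounded_bilinear_matrix_mult]
        linear_continuous_on continuous_on_id continuous_on_const
        linear_conv_bounded_linear[THEN iffD1, OF linear_transpose])
  ultimately show ?thesis by (simp add: compact_eq_bounded_closed)
qed

text \<open>
  The Householder reflection in the hyperplane orthogonal to \<open>u\<close>.
\<close>
definition reflection :: "real^'r \<Rightarrow> real^'r^'r" where
  "reflection u = mat 1 - (2 / (u \<bullet> u)) *\<^sub>R outer u u"

lemma orthogonal_reflection:
  assumes "u \<noteq> 0"
  shows "orthogonal_matrix (reflection u)"
proof -
  have "reflection u ** reflection u = mat 1"
    using assms by (simp add: reflection_def matrix_mult_distribs outer_mult_outer scaleR_2
        algebra_simps flip: scaleR_add_left)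
  moreover have "transpose (reflection u) = reflection u"
    by (simp add: reflection_def transpose_distribs transpose_outer)
  ultimately show ?thesis by (simp add: orthogonal_matrix)
qed

lemma linear_le_quadratic_imp_zero:
  fixes a c :: real
  assumes "\<And>t. t * a \<le> t\<^sup>2 * c"
  shows "a = 0"
proof (rule ccontr)
  assume "a \<noteq> 0"
  define t where "t = a / (1 + \<bar>c\<bar>)"
  have "1 + \<bar>c\<bar> \<noteq> 0" by simp
  then have ta: "t * (1 + \<bar>c\<bar>) = a" by (simp add: t_def)
  then have "t \<noteq> 0" using \<open>a \<noteq> 0\<close> by auto
  then have "t * t > 0" using zero_less_power2[of t] by (simp only: power2_eq_square simp_thms)
  have "t * a \<le> t * t * c" using assms[of t] by (simp add: power2_eq_square)
  also have "\<dots> \<le> t * t * \<bar>c\<bar>" by (intro mult_left_mono) auto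
  also have "\<dots> < t * t * (1 + \<bar>c\<bar>)"
    using \<open>t * t > 0\<close> by (intro mult_strict_left_mono) auto
  also have "\<dots> = t * a" by (simp only: mult.assoc ta)
  finally show False by simp
qed

text \<open>
  Testing the maximality with one reflection gives positive semidefiniteness. Testing it with the
  product of the reflections along \<open>u\<close> and \<open>u + t w\<close>, a rotation close to the identity for small \<open>t\<close>,
  gives an inequality whose first-order term in \<open>t\<close> is a multiple of \<open>u \<bullet> N w - w \<bullet> N u\<close>.
\<close>
lemma trace_maximal_imp_symmetric_psd:
  fixes N :: "real^'r^'r"
  assumes max: "\<And>Q. orthogonal_matrix Q \<Longrightarrow> N \<bullet> Q \<le> N \<bullet> mat 1"
  shows "transpose N = N" and "0 \<le> u \<bullet> (N *v u)"
proof -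
  show psd: "0 \<le> u \<bullet> (N *v u)"
  proof (cases "u = 0")
    case False
    define k where "k = 2 / (u \<bullet> u)"
    have "0 < k" using False by (simp add: k_def)
    moreover have "0 \<le> k * (u \<bullet> (N *v u))"
      using max[OF orthogonal_reflection[OF False]]
      by (simp add: reflection_def inner_diff_right inner_outer flip: k_def)
    ultimately show ?thesis by (simp add: zero_le_mult_iff)
  qed simp
  have two: "2 * (u \<bullet> v) * (u \<bullet> (N *v v)) \<le> (v \<bullet> v) * (u \<bullet> (N *v u)) + (u \<bullet> u) * (v \<bullet> (N *v v))"
    for u v
  proof (cases "u = 0 \<or> v = 0")
    case False
    then have "N \<bullet> (reflection u ** reflection v) \<le> N \<bullet> mat 1"
      by (intro max orthogonal_matrix_mul orthogonal_reflection) auto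
    then have "4 * (u \<bullet> v) * (u \<bullet> (N *v v)) / ((u \<bullet> u) * (v \<bullet> v))
        \<le> 2 * (u \<bullet> (N *v u)) / (u \<bullet> u) + 2 * (v \<bullet> (N *v v)) / (v \<bullet> v)"
      by (simp add: reflection_def matrix_mult_distribs outer_mult_outer inner_diff_right
          inner_add_right inner_outer algebra_simps)
    moreover have "0 < u \<bullet> u" "0 < v \<bullet> v" using False by auto
    ultimately show ?thesis by (simp add: field_simps)
  qed auto
  have "u \<bullet> (N *v w) = w \<bullet> (N *v u)" for u w
  proof (cases "u = 0")
    case False
    have "t * ((u \<bullet> u) * (u \<bullet> (N *v w) - w \<bullet> (N *v u)))
      \<le> t\<^sup>2 * ((w \<bullet> w) * (u \<bullet> (N *v u)) + (u \<bullet> u) * (w \<bullet> (N *v w)) - 2 * (u \<bullet> w) * (u \<bullet> (N *v w)))" for t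
      using two[of u "u + t *\<^sub>R w"]
      by (simp add: matrix_vector_right_distrib matrix_vector_mult_scaleR inner_add_left
          inner_add_right inner_commute[of w u] power2_eq_square algebra_simps)
    from linear_le_quadratic_imp_zero[OF this] False show ?thesis by simp
  qed simp
  then have "(transpose N *v u) \<bullet> w = (N *v u) \<bullet> w" for u w
    by (simp add: dot_lmul_matrix inner_commute del: transpose_matrix_vector)
       (metis dot_lmul_matrix inner_commute transpose_matrix_vector)
  then have "transpose N *v u = N *v u" for u
    using vector_eq_rdot[of "transpose N *v u" "N *v u"] by blast
  then show "transpose N = N" unfolding matrix_eq by blast
qed

text \<open>
  The matrix \<open>R\<close> maximizes the trace of \<open>M ** R\<close> over the compact orthogonal group.
\<close>
lemma procrustes_alignment:
  fixes M :: "real^'r^'r"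
  obtains R where "orthogonal_matrix R" "transpose (M ** R) = M ** R"
    "\<And>x. 0 \<le> x \<bullet> ((M ** R) *v x)"
proof -
  have "\<exists>R\<in>{R. orthogonal_matrix R}. \<forall>Q\<in>{R. orthogonal_matrix R}. transpose M \<bullet> Q \<le> transpose M \<bullet> R"
    by (rule continuous_attains_sup[OF compact_orthogonal_matrices])
      (use orthogonal_matrix_id in \<open>auto intro!: continuous_intros\<close>)
  then obtain R where R: "orthogonal_matrix R"
    and max: "\<And>Q. orthogonal_matrix Q \<Longrightarrow> transpose M \<bullet> Q \<le> transpose M \<bullet> R" by auto
  define N where "N = transpose (M ** R)"
  have "N \<bullet> Q = transpose M \<bullet> (R ** Q)" for Q
    by (metis N_def inner_commute inner_matrix_mult_right matrix_transpose_mul)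
  then have "N \<bullet> Q \<le> N \<bullet> mat 1" if "orthogonal_matrix Q" for Q
    using max[OF orthogonal_matrix_mul[OF R that]] by simp
  from trace_maximal_imp_symmetric_psd[OF this] have N: "transpose N = N" "\<And>u. 0 \<le> u \<bullet> (N *v u)"
    by blast+
  then have "M ** R = N" by (metis N_def transpose_transpose)
  with R N that show thesis by simp
qed

section \<open>The nuclear norm and balanced factorizations\<close>

lemma nuclear_norm_eigenbasis:
  fixes X :: "real^'n^'m"
  assumes B: "eigenbasis (transpose X ** X) B"
  shows "nuclear_norm X = (\<Sum>b\<in>B. norm (X *v b))"
proof -
  define A where "A = transpose X ** X"
  have sym: "transpose A = A" by (simp add: A_def matrix_transpose_mul)
  have B': "eigenbasis A B" using B by (simp add: A_def)
  have on: "orthonormal_basis B" and fin: "finite B"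
    using B by (auto simp: eigenbasis_def orthonormal_basis_def)
  have Ab: "A *v b = (norm (X *v b))\<^sup>2 *\<^sub>R b" if "b \<in> B" for b
    using B' that by (simp add: eigenbasis_def) (simp add: A_def gram_form power2_norm_eq_inner)
  have dim: "dim {v. A *v v = s\<^sup>2 *\<^sub>R v} = card {b \<in> B. norm (X *v b) = s}" if "0 \<le> s" for s
  proof -
    let ?C = "{b \<in> B. norm (X *v b) = s}"
    have "{v. A *v v = s\<^sup>2 *\<^sub>R v} = span ?C"
    proof
      show "{v. A *v v = s\<^sup>2 *\<^sub>R v} \<subseteq> span ?C"
      proof
        fix v assume "v \<in> {v. A *v v = s\<^sup>2 *\<^sub>R v}"
        then have v: "A *v v = s\<^sup>2 *\<^sub>R v" by simp
        have "v \<bullet> b = 0" if "b \<in> B" "norm (X *v b) \<noteq> s" for b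
        proof -
          have "s\<^sup>2 * (v \<bullet> b) = (norm (X *v b))\<^sup>2 * (v \<bullet> b)"
            using symmetric_inner_matrix[OF sym, of v b] Ab[OF that(1)] v by simp
          then show ?thesis using that(2) \<open>0 \<le> s\<close> by auto
        qed
        then have "(v \<bullet> b) *\<^sub>R b \<in> span ?C" if "b \<in> B" for b
          using that by (cases "norm (X *v b) = s") (auto intro: span_scale span_base span_zero)
        then have "(\<Sum>b\<in>B. (v \<bullet> b) *\<^sub>R b) \<in> span ?C" by (rule span_sum)
        then show "v \<in> span ?C" by (simp add: orthonormal_expand[OF on])
      qed
      show "span ?C \<subseteq> {v. A *v v = s\<^sup>2 *\<^sub>R v}"
      proof (rule span_minimal)
        show "subspace {v. A *v v = s\<^sup>2 *\<^sub>R v}"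
          by (auto simp: subspace_def matrix_vector_right_distrib matrix_vector_mult_scaleR scaleR_add_right)
      qed (use Ab in auto)
    qed
    moreover have "independent ?C"
      using on by (intro pairwise_orthogonal_independent)
        (auto simp: orthonormal_basis_def pairwise_def)
    ultimately show ?thesis by (simp add: dim_span dim_eq_card_independent)
  qed
  have sv: "{s. singular_value X s} = (\<lambda>b. norm (X *v b)) ` B"
  proof
    show "(\<lambda>b. norm (X *v b)) ` B \<subseteq> {s. singular_value X s}"
      using eigenvalue_eigenbasis[OF B symmetric_gram]
      by (auto simp: singular_value_def gram_form power2_norm_eq_inner)
    show "{s. singular_value X s} \<subseteq> (\<lambda>b. norm (X *v b)) ` B"
    proof
      fix s assume "s \<in> {s. singular_value X s}"
      then obtain v where s: "0 \<le> s" and v: "v \<noteq> 0" "A *v v = s\<^sup>2 *\<^sub>R v"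
        by (auto simp: singular_value_def eigenvalue_def A_def)
      have "dim {v. A *v v = s\<^sup>2 *\<^sub>R v} \<noteq> 0" using v by (auto simp: dim_eq_0)
      then have "{b \<in> B. norm (X *v b) = s} \<noteq> {}" using dim[OF s] by (metis card.empty)
      then show "s \<in> (\<lambda>b. norm (X *v b)) ` B" by auto
    qed
  qed
  have "nuclear_norm X = (\<Sum>s\<in>(\<lambda>b. norm (X *v b)) ` B. real (card {b \<in> B. norm (X *v b) = s}) * s)"
    unfolding nuclear_norm_def sv A_def[symmetric] by (rule sum.cong) (auto simp: dim)
  also have "\<dots> = (\<Sum>s\<in>(\<lambda>b. norm (X *v b)) ` B. \<Sum>b\<in>{b \<in> B. norm (X *v b) = s}. norm (X *v b))"
    by (rule sum.cong) auto
  also have "\<dots> = (\<Sum>b\<in>B. norm (X *v b))"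
    using sum.image_gen[OF fin, of "\<lambda>b. norm (X *v b)" "\<lambda>b. norm (X *v b)"] by simp
  finally show ?thesis .
qed

lemma eigenbasis_images_orthogonal:
  assumes B: "eigenbasis (transpose X ** X) B" and "b \<in> B" "c \<in> B" "b \<noteq> c"
  shows "(X *v b) \<bullet> (X *v c) = 0"
proof -
  have "(X *v b) \<bullet> (X *v c) = b \<bullet> ((transpose X ** X) *v c)" by (simp add: gram_form)
  also have "\<dots> = (c \<bullet> ((transpose X ** X) *v c)) * (b \<bullet> c)"
    using assms unfolding eigenbasis_def by (metis inner_scaleR_right)
  also have "b \<bullet> c = 0"
    using orthonormal_inner[of B b c] assms by (simp add: eigenbasis_def)
  finally show ?thesis by simp
qed

text \<open>
  The partial isometry \<open>T = \<Sum> u\<^sub>b b\<^sup>T\<close> built from the right singular vectors \<open>b\<close> and the left singular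
  vectors \<open>u\<^sub>b\<close> shows that the dual description of the nuclear norm is attained.
\<close>
lemma nuclear_norm_dual:
  fixes X :: "real^'n^'m"
  obtains T where "X \<bullet> T = nuclear_norm X" "\<And>x. norm (T *v x) \<le> norm x"
proof -
  obtain B where B: "eigenbasis (transpose X ** X) B"
    using eigenbasis_exists[OF symmetric_gram] .
  have on: "orthonormal_basis B" and fin: "finite B"
    using B by (auto simp: eigenbasis_def orthonormal_basis_def)
  define u where "u b = X *v b /\<^sub>R norm (X *v b)" for b
  define T where "T = (\<Sum>b\<in>B. outer (u b) b)"
  have "X \<bullet> T = (\<Sum>b\<in>B. u b \<bullet> (X *v b))" by (simp add: T_def inner_sum_right inner_outer)
  also have "\<dots> = (\<Sum>b\<in>B. norm (X *v b))"
    by (intro sum.cong refl) (simp add: u_def divide_simps flip: power2_norm_eq_inner, simp add: power2_eq_square)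
  also have "\<dots> = nuclear_norm X" by (simp add: nuclear_norm_eigenbasis[OF B])
  finally have 1: "X \<bullet> T = nuclear_norm X" .
  have 2: "norm (T *v x) \<le> norm x" for x
  proof -
    have Tx: "T *v x = (\<Sum>b\<in>B. (b \<bullet> x) *\<^sub>R u b)"
      by (simp add: T_def sum_mult_vector outer_mult_vector)
    have "pairwise (\<lambda>b c. orthogonal ((b \<bullet> x) *\<^sub>R u b) ((c \<bullet> x) *\<^sub>R u c)) B"
      using eigenbasis_images_orthogonal[OF B] by (auto simp: pairwise_def orthogonal_def u_def)
    then have "(norm (T *v x))\<^sup>2 = (\<Sum>b\<in>B. (norm ((b \<bullet> x) *\<^sub>R u b))\<^sup>2)"
      unfolding Tx by (rule norm_sum_Pythagorean[OF fin])
    also have "\<dots> \<le> (\<Sum>b\<in>B. (x \<bullet> b)\<^sup>2)"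
    proof (rule sum_mono)
      fix b assume "b \<in> B"
      have "norm (u b) \<le> 1" by (cases "X *v b = 0") (simp_all add: u_def)
      then have "(norm (u b))\<^sup>2 \<le> 1" by (simp add: power_le_one)
      then have "(b \<bullet> x)\<^sup>2 * (norm (u b))\<^sup>2 \<le> (b \<bullet> x)\<^sup>2 * 1" by (intro mult_left_mono) auto
      then show "(norm ((b \<bullet> x) *\<^sub>R u b))\<^sup>2 \<le> (x \<bullet> b)\<^sup>2"
        by (simp add: power_mult_distrib inner_commute)
    qed
    also have "\<dots> = (norm x)\<^sup>2" by (simp add: parseval_norm[OF on])
    finally show ?thesis by (simp add: power2_le_iff_abs_le)
  qed
  show thesis using that 1 2 .
qed

lemma contraction_inner_product_le:
  fixes T :: "real^'n^'m" and U :: "real^'k^'m" and V :: "real^'k^'n"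
  assumes T: "\<And>x. norm (T *v x) \<le> norm x"
  shows "(U ** transpose V) \<bullet> T \<le> ((norm U)\<^sup>2 + (norm V)\<^sup>2) / 2"
proof -
  have col: "(norm M)\<^sup>2 = (\<Sum>j\<in>UNIV. (norm (column j M))\<^sup>2)" for M :: "real^'k^'l"
    unfolding power2_norm_eq_inner column_def inner_vec_def by (simp, rule sum.swap)
  have "(norm (T ** V))\<^sup>2 \<le> (norm V)\<^sup>2"
    unfolding col column_matrix_mult by (intro sum_mono power_mono T) auto
  moreover have "0 \<le> (U - T ** V) \<bullet> (U - T ** V)" by simp
  moreover have "(U ** transpose V) \<bullet> T = U \<bullet> (T ** V)"
    by (simp add: inner_matrix_mult_left)
  ultimately show ?thesis
    by (simp add: power2_norm_eq_inner inner_diff_left inner_diff_right inner_commute[of "T ** V" U])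
qed


definition diag :: "('r \<Rightarrow> real) \<Rightarrow> real^'r^'r" where
  "diag d = (\<chi> i j. if i = j then d i else 0)"

lemma matrix_mult_transpose_columns:
  "(U :: real^'r^'m) ** transpose (V :: real^'r^'n) = (\<Sum>j\<in>UNIV. outer (column j U) (column j V))"
  by (simp add: vec_eq_iff matrix_matrix_mult_def transpose_def outer_def column_def)

text \<open>
  The columns of \<open>V\<close> and \<open>U\<close> are the right and left singular vectors for the nonzero singular values,
  scaled by the square root of the singular value and padded with zero columns. The columns are
  indexed by an injection of the singular vectors into the index type.
\<close>
lemma balanced_svd_factorization:
  fixes X :: "real^'q^'p"
  assumes rank: "rank X \<le> CARD('r)"
  obtains U :: "real^'r^'p" and V :: "real^'r^'q" and d where
    "U ** transpose V = X" "transpose U ** U = diag d" "transpose V ** V = diag d"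
    "\<And>j. 0 \<le> d j" "\<And>j. d j \<noteq> 0 \<Longrightarrow> rho X \<le> d j"
    "sum d UNIV = nuclear_norm X" "\<And>j. rank X = CARD('r) \<Longrightarrow> d j \<noteq> 0"
proof -
  obtain B where B: "eigenbasis (transpose X ** X) B"
    using eigenbasis_exists[OF symmetric_gram] .
  have on: "orthonormal_basis B" and fin: "finite B"
    using B by (auto simp: eigenbasis_def orthonormal_basis_def)
  define P where "P = {b \<in> B. X *v b \<noteq> 0}"
  have finP: "finite P" using fin by (simp add: P_def)
  have orth: "(X *v b) \<bullet> (X *v c) = 0" if "b \<in> P" "c \<in> P" "b \<noteq> c" for b c
    using eigenbasis_images_orthogonal[OF B] that by (simp add: P_def)
  have expand: "X *v x = (\<Sum>b\<in>P. (b \<bullet> x) *\<^sub>R (X *v b))" for x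
  proof -
    have "X *v x = X *v (\<Sum>b\<in>B. (x \<bullet> b) *\<^sub>R b)" by (simp add: orthonormal_expand[OF on])
    also have "\<dots> = (\<Sum>b\<in>B. (b \<bullet> x) *\<^sub>R (X *v b))"
      by (simp add: linear_sum[OF matrix_vector_mul_linear] matrix_vector_mult_scaleR inner_commute)
    also have "\<dots> = (\<Sum>b\<in>P. (b \<bullet> x) *\<^sub>R (X *v b))"
      by (rule sum.mono_neutral_right) (auto simp: P_def fin)
    finally show ?thesis .
  qed
  have inj: "inj_on ((*v) X) P"
  proof (rule inj_onI)
    fix b c assume bc: "b \<in> P" "c \<in> P" "X *v b = X *v c"
    then have "(X *v b) \<bullet> (X *v c) \<noteq> 0" by (simp add: P_def)
    then show "b = c" using orth bc by blast
  qed
  have card: "card P = rank X"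
  proof (rule antisym)
    have "pairwise orthogonal ((*v) X ` P)"
      using orth by (auto simp: pairwise_def orthogonal_def)
    then have "independent ((*v) X ` P)"
      by (rule pairwise_orthogonal_independent) (auto simp: P_def)
    then have "card ((*v) X ` P) \<le> dim (range ((*v) X))"
      by (intro independent_card_le_dim) auto
    then show "card P \<le> rank X" by (simp add: card_image[OF inj] rank_dim_range)
    have "X *v x \<in> span ((*v) X ` P)" for x
      unfolding expand[of x] by (intro span_sum span_scale span_base imageI)
    then have "range ((*v) X) \<subseteq> span ((*v) X ` P)" by blast
    then have "dim (range ((*v) X)) \<le> card ((*v) X ` P)"
      using finP by (intro dim_le_card) auto
    then show "rank X \<le> card P" by (simp add: card_image[OF inj] rank_dim_range)
  qed
  then obtain k :: "real^'q \<Rightarrow> 'r" where k: "inj_on k P"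
    using card_le_inj[OF finP finite_class.finite_UNIV] rank by auto
  (* The singular vector with index j, or zero if j indexes a padding column. Division by zero
     makes the corresponding column of U vanish as well. *)
  define w where "w j = (if j \<in> k ` P then inv_into P k j else 0)" for j
  have wk: "w (k b) = b" if "b \<in> P" for b using that k by (simp add: w_def)
  have w_cases: "w j \<in> P \<and> k (w j) = j \<or> w j = 0" for j
    by (auto simp: w_def wk inv_into_into f_inv_into_f k)
  have reindex: "(\<Sum>j\<in>UNIV. F (w j)) = (\<Sum>b\<in>P. F b)" if "F 0 = 0" for F :: "real^'q \<Rightarrow> 'z::comm_monoid_add"
  proof -
    have "(\<Sum>j\<in>UNIV. F (w j)) = (\<Sum>j\<in>k ` P. F (w j))"
      by (rule sum.mono_neutral_right) (auto simp: w_def that)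
    also have "\<dots> = (\<Sum>b\<in>P. F b)" by (simp add: sum.reindex[OF k] wk)
    finally show ?thesis .
  qed
  define d where "d j = norm (X *v w j)" for j
  define U :: "real^'r^'p" where "U = (\<chi> i j. (1 / sqrt (d j)) * (X *v w j) $ i)"
  define V :: "real^'r^'q" where "V = (\<chi> i j. sqrt (d j) * w j $ i)"
  have colU: "column j U = (1 / sqrt (d j)) *\<^sub>R (X *v w j)" for j
    by (simp add: U_def column_def vec_eq_iff)
  have colV: "column j V = sqrt (d j) *\<^sub>R w j" for j
    by (simp add: V_def column_def vec_eq_iff)
  have d0: "X *v w j = 0" if "d j = 0" for j using that by (simp add: d_def)
  have "outer (column j U) (column j V) = outer (X *v w j) (w j)" for j
  proof (cases "d j = 0")
    case True
    then show ?thesis by (simp add: colU d0 outer_def vec_eq_iff)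
  next
    case False
    then have "0 < d j" by (simp add: d_def)
    then show ?thesis by (simp add: colU colV outer_def vec_eq_iff)
  qed
  then have "U ** transpose V = (\<Sum>j\<in>UNIV. outer (X *v w j) (w j))"
    by (simp add: matrix_mult_transpose_columns)
  also have "\<dots> = (\<Sum>b\<in>P. outer (X *v b) b)"
    by (rule reindex) (simp add: outer_def vec_eq_iff)
  also have "\<dots> = X"
    by (simp add: matrix_eq sum_mult_vector outer_mult_vector expand[symmetric])
  finally have UV: "U ** transpose V = X" .
  have w_orth: "w i \<bullet> w j = 0" "(X *v w i) \<bullet> (X *v w j) = 0" if "i \<noteq> j" for i j
  proof -
    have distinct: "w i = 0 \<or> w j = 0 \<or> w i \<in> P \<and> w j \<in> P \<and> w i \<noteq> w j"
      using w_cases[of i] w_cases[of j] that by metis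
    then show "(X *v w i) \<bullet> (X *v w j) = 0" using orth[of "w i" "w j"] by auto
    show "w i \<bullet> w j = 0"
      using distinct orthonormal_inner[OF on, of "w i" "w j"] by (auto simp: P_def)
  qed
  have w_norm: "d j * (w j \<bullet> w j) = d j" for j
    using w_cases[of j] orthonormal_inner[OF on, of "w j" "w j"] by (auto simp: P_def d_def)
  have UU: "transpose U ** U = diag d"
  proof -
    have "column i U \<bullet> column j U = (if i = j then d i else 0)" for i j
    proof (cases "i = j")
      case True
      have "column i U \<bullet> column i U = (1 / sqrt (d i) * (1 / sqrt (d i))) * (d i)\<^sup>2"
        by (simp add: colU d_def power2_norm_eq_inner)
      also have "\<dots> = d i" by (simp add: d_def power2_eq_square)
      finally show ?thesis using True by simp
    qed (simp add: colU w_orth)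
    then show ?thesis by (simp add: matrix_mult_transpose_dot_column diag_def)
  qed
  have VV: "transpose V ** V = diag d"
  proof -
    have "column i V \<bullet> column j V = (if i = j then d i else 0)" for i j
    proof (cases "i = j")
      case True
      have "column i V \<bullet> column i V = (sqrt (d i) * sqrt (d i)) * (w i \<bullet> w i)" by (simp add: colV)
      also have "\<dots> = d i" using w_norm[of i] by (simp add: d_def)
      finally show ?thesis using True by simp
    qed (simp add: colV w_orth)
    then show ?thesis by (simp add: matrix_mult_transpose_dot_column diag_def)
  qed
  have "sum d UNIV = (\<Sum>b\<in>P. norm (X *v b))" unfolding d_def by (rule reindex) simp
  also have "\<dots> = (\<Sum>b\<in>B. norm (X *v b))"
    by (rule sum.mono_neutral_left) (auto simp: P_def fin)
  finally have sum_d: "sum d UNIV = nuclear_norm X" by (simp add: nuclear_norm_eigenbasis[OF B])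
  have rho: "rho X \<le> d j" if "d j \<noteq> 0" for j
    using rho_le_norm_eigenvector[OF B, of "w j"] w_cases[of j] that by (auto simp: d_def P_def)
  have full: "d j \<noteq> 0" if "rank X = CARD('r)" for j
  proof -
    have "card (k ` P) = CARD('r)" using that by (simp add: card_image[OF k] card)
    then have "k ` P = UNIV" by (intro card_subset_eq) auto
    then obtain b where "b \<in> P" "j = k b" by blast
    then show ?thesis by (simp add: d_def wk P_def)
  qed
  show thesis
    by (rule that[OF UV UU VV _ rho sum_d full]) (auto simp: d_def)
qed

lemma diag_mult_vector: "diag d *v x = (\<chi> j. d j * x $ j)"
  by (simp add: diag_def matrix_vector_mult_def vec_eq_iff if_distrib[of "\<lambda>c. c * _"] cong: if_cong)

lemma norm_gram_diag:
  assumes "transpose V ** V = diag d"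
  shows "(norm V)\<^sup>2 = sum d UNIV"
proof -
  have "(norm V)\<^sup>2 = (V ** mat 1) \<bullet> V" by (simp add: power2_norm_eq_inner)
  also have "\<dots> = mat 1 \<bullet> diag d" unfolding inner_matrix_mult_right assms ..
  also have "\<dots> = sum d UNIV"
    by (simp add: inner_vec_def mat_def diag_def if_distrib[of "\<lambda>c. c * _"] cong: if_cong)
  finally show ?thesis .
qed

section \<open>Second derivatives and Hessians\<close>

text \<open>
  The derivatives are curried functions, not elements of a space of bounded linear maps, so that
  those of the factored objective can be written as explicit formulas.
\<close>
definition second_order_derivatives ::
  "('a::real_normed_vector \<Rightarrow> real) \<Rightarrow> ('a \<Rightarrow> 'a \<Rightarrow> real) \<Rightarrow> ('a \<Rightarrow> 'a \<Rightarrow> 'a \<Rightarrow> real) \<Rightarrow> bool" where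
  "second_order_derivatives h h1 h2 \<longleftrightarrow>
     (\<forall>Z. (h has_derivative h1 Z) (at Z)) \<and>
     (\<forall>Z D. ((\<lambda>Y. h1 Y D) has_derivative (\<lambda>G. h2 Z G D)) (at Z)) \<and>
     (\<forall>Z G. linear (h2 Z G)) \<and> (\<forall>Z G D. h2 Z G D = h2 Z D G)"

lemma directional_derivative:
  fixes h :: "'a::real_normed_vector \<Rightarrow> real"
  assumes "(h has_derivative h') (at (Z + s *\<^sub>R G))"
  shows "((\<lambda>t. h (Z + t *\<^sub>R G)) has_field_derivative h' G) (at s)"
proof -
  have "((\<lambda>t. Z + t *\<^sub>R G) has_derivative (\<lambda>t. t *\<^sub>R G)) (at s)"
    by (auto intro!: derivative_eq_intros)
  from has_derivative_compose[OF this assms]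
  have "((\<lambda>t. h (Z + t *\<^sub>R G)) has_derivative (\<lambda>t. h' (t *\<^sub>R G))) (at s)" .
  moreover have "(\<lambda>t. h' (t *\<^sub>R G)) = (*) (h' G)"
    using linear_scale[OF has_derivative_linear[OF assms]] by (auto simp: mult.commute)
  ultimately show ?thesis by (simp add: has_field_derivative_def)
qed

lemma partial_deriv_eq:
  assumes "(h has_derivative h') (at Z)"
  shows "partial_deriv i j h Z = h' (axis i (axis j 1))"
  unfolding partial_deriv_def
  by (rule DERIV_imp_deriv) (rule directional_derivative, simp add: assms)

lemma matrix_unit_expansion:
  "(G :: real^'n^'m) = (\<Sum>i\<in>UNIV. \<Sum>j\<in>UNIV. G $ i $ j *\<^sub>R axis i (axis j 1))"
proof -
  have "G $ k $ l = (\<Sum>i\<in>UNIV. \<Sum>j\<in>UNIV. if i = k \<and> j = l then G $ i $ j else 0)" for k l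
  proof -
    have "(\<Sum>i\<in>UNIV. \<Sum>j\<in>UNIV. if i = k \<and> j = l then G $ i $ j else 0)
      = (\<Sum>i\<in>UNIV. if i = k then \<Sum>j\<in>UNIV. if j = l then G $ i $ j else 0 else 0)"
      by (intro sum.cong) auto
    then show ?thesis by simp
  qed
  then show ?thesis
    by (auto simp: vec_eq_iff axis_def intro!: sum.cong)
qed

lemma linear_matrix_units:
  fixes L :: "real^'n^'m \<Rightarrow> real"
  assumes "linear L"
  shows "L G = (\<Sum>i\<in>UNIV. \<Sum>j\<in>UNIV. G $ i $ j * L (axis i (axis j 1)))"
proof -
  have "L G = L (\<Sum>i\<in>UNIV. \<Sum>j\<in>UNIV. G $ i $ j *\<^sub>R axis i (axis j 1))"
    by (simp flip: matrix_unit_expansion)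
  then show ?thesis
    by (simp add: linear_sum[OF assms] linear_scale[OF assms])
qed

lemma partial_deriv_partial_deriv:
  assumes "second_order_derivatives h h1 h2"
  shows "partial_deriv i j (partial_deriv k l h) Z = h2 Z (axis i (axis j 1)) (axis k (axis l 1))"
proof -
  have "partial_deriv k l h = (\<lambda>Y. h1 Y (axis k (axis l 1)))"
    by (intro ext partial_deriv_eq) (use assms in \<open>simp add: second_order_derivatives_def\<close>)
  moreover have "((\<lambda>Y. h1 Y (axis k (axis l 1))) has_derivative (\<lambda>G. h2 Z G (axis k (axis l 1)))) (at Z)"
    using assms by (simp add: second_order_derivatives_def)
  ultimately show ?thesis by (simp only: partial_deriv_eq)
qed

lemma second_derivative_linear_left:
  assumes "second_order_derivatives h h1 h2"
  shows "linear (\<lambda>G. h2 Z G D)"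
  using assms unfolding second_order_derivatives_def by (blast intro: has_derivative_linear)

lemma hessian_form_eq:
  assumes so: "second_order_derivatives h h1 h2"
  shows "hessian_form h Z G H = h2 Z G H"
proof -
  have lin: "linear (h2 Z E)" for E using so by (simp add: second_order_derivatives_def)
  have "h2 Z G H = (\<Sum>i\<in>UNIV. \<Sum>j\<in>UNIV. G $ i $ j *
      (\<Sum>k\<in>UNIV. \<Sum>l\<in>UNIV. H $ k $ l * h2 Z (axis i (axis j 1)) (axis k (axis l 1))))"
    using linear_matrix_units[OF second_derivative_linear_left[OF so, of Z H], of G]
    by (simp flip: linear_matrix_units[OF lin])
  then show ?thesis
    by (simp add: hessian_form_def partial_deriv_partial_deriv[OF so] sum_distrib_left mult_ac)
qed

lemma critical_point_derivative_zero:
  assumes "(h has_derivative h') (at Z)" and "critical_point h Z"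
  shows "h' D = 0"
proof -
  have "h' (axis i (axis j 1)) = 0" for i j
    using assms(2) partial_deriv_eq[OF assms(1), of i j]
    by (simp add: critical_point_def gradient_def vec_eq_iff)
  then show ?thesis
    using linear_matrix_units[OF has_derivative_linear[OF assms(1)], of D] by simp
qed

definition vectorize :: "real^'n^'m \<Rightarrow> real^('m \<times> 'n)" where
  "vectorize D = (\<chi> a. D $ fst a $ snd a)"

lemma sum_UNIV_prod:
  "(\<Sum>a\<in>(UNIV :: ('m::finite \<times> 'n::finite) set). F a) = (\<Sum>i\<in>UNIV. \<Sum>j\<in>UNIV. F (i, j))"
  by (simp add: sum.cartesian_product flip: UNIV_Times_UNIV)

lemma inner_vectorize: "vectorize D \<bullet> vectorize D = D \<bullet> D"
  by (simp add: vectorize_def inner_vec_def sum_UNIV_prod)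

lemma hessian_matrix_symmetric:
  assumes "second_order_derivatives h h1 h2"
  shows "transpose (hessian_matrix h Z) = hessian_matrix h Z"
  using assms
  by (simp add: vec_eq_iff transpose_def hessian_matrix_def partial_deriv_partial_deriv)
     (simp add: second_order_derivatives_def)

lemma hessian_matrix_form:
  assumes so: "second_order_derivatives h h1 h2"
  shows "vectorize D \<bullet> (hessian_matrix h Z *v vectorize D) = h2 Z D D"
  unfolding hessian_form_eq[OF so, symmetric]
  by (simp add: hessian_form_def hessian_matrix_def vectorize_def inner_vec_def
      matrix_vector_mult_def sum_UNIV_prod sum_distrib_left mult_ac)

lemma lambda_min_hessian_le:
  assumes so: "second_order_derivatives h h1 h2"
  shows "lambda_min (hessian_matrix h Z) * (norm D)\<^sup>2 \<le> h2 Z D D"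
  using lambda_min_le_form[OF hessian_matrix_symmetric[OF so], of Z "vectorize D"]
  by (simp add: hessian_matrix_form[OF so] inner_vectorize power2_norm_eq_inner)

lemma second_difference_mean_value:
  fixes f :: "'a::real_normed_vector \<Rightarrow> real"
  assumes f1: "\<And>Z. (f has_derivative f1 Z) (at Z)"
    and f2: "\<And>Z D. ((\<lambda>Y. f1 Y D) has_derivative (\<lambda>G. f2 Z G D)) (at Z)"
    and "0 < t"
  shows "\<exists>s u. 0 < s \<and> s < t \<and> 0 < u \<and> u < t \<and>
    f (Z + t *\<^sub>R G + t *\<^sub>R H) - f (Z + t *\<^sub>R G) - f (Z + t *\<^sub>R H) + f Z
      = t * t * f2 (Z + s *\<^sub>R G + u *\<^sub>R H) H G"
proof -
  have "((\<lambda>s. f (Z + t *\<^sub>R H + s *\<^sub>R G) - f (Z + s *\<^sub>R G)) has_field_derivative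
      (f1 (Z + t *\<^sub>R H + s *\<^sub>R G) G - f1 (Z + s *\<^sub>R G) G)) (at s)" for s
    by (intro DERIV_diff directional_derivative f1)
  then obtain s where s: "0 < s" "s < t" and
    eq1: "(f (Z + t *\<^sub>R H + t *\<^sub>R G) - f (Z + t *\<^sub>R G)) - (f (Z + t *\<^sub>R H + 0 *\<^sub>R G) - f (Z + 0 *\<^sub>R G))
      = (t - 0) * (f1 (Z + t *\<^sub>R H + s *\<^sub>R G) G - f1 (Z + s *\<^sub>R G) G)"
    using MVT2[OF \<open>0 < t\<close>, of "\<lambda>s. f (Z + t *\<^sub>R H + s *\<^sub>R G) - f (Z + s *\<^sub>R G)"
      "\<lambda>s. f1 (Z + t *\<^sub>R H + s *\<^sub>R G) G - f1 (Z + s *\<^sub>R G) G"] by blast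
  have "((\<lambda>u. f1 (Z + s *\<^sub>R G + u *\<^sub>R H) G) has_field_derivative
      f2 (Z + s *\<^sub>R G + u *\<^sub>R H) H G) (at u)" for u
    using directional_derivative[OF f2] .
  then obtain u where u: "0 < u" "u < t" and
    eq2: "f1 (Z + s *\<^sub>R G + t *\<^sub>R H) G - f1 (Z + s *\<^sub>R G + 0 *\<^sub>R H) G
      = (t - 0) * f2 (Z + s *\<^sub>R G + u *\<^sub>R H) H G"
    using MVT2[OF \<open>0 < t\<close>, of "\<lambda>u. f1 (Z + s *\<^sub>R G + u *\<^sub>R H) G"
      "\<lambda>u. f2 (Z + s *\<^sub>R G + u *\<^sub>R H) H G"] by blast
  have "f (Z + t *\<^sub>R G + t *\<^sub>R H) - f (Z + t *\<^sub>R G) - f (Z + t *\<^sub>R H) + f Z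
      = t * t * f2 (Z + s *\<^sub>R G + u *\<^sub>R H) H G"
    using eq1 eq2 by (simp add: add.assoc add.commute[of "t *\<^sub>R H"] mult.assoc)
  with s u show ?thesis by blast
qed

text \<open>
  Schwarz's theorem: by the mean value theorem the same second difference of \<open>f\<close> equals \<open>t\<^sup>2\<close> times
  the second derivative in either order, at two points that approach \<open>Z\<close> as \<open>t\<close> tends to zero.
\<close>
lemma second_derivative_symmetric:
  fixes f :: "'a::real_normed_vector \<Rightarrow> real"
  assumes f1: "\<And>Z. (f has_derivative f1 Z) (at Z)"
    and f2: "\<And>Z D. ((\<lambda>Y. f1 Y D) has_derivative (\<lambda>G. f2 Z G D)) (at Z)"
    and cont: "\<And>G H. continuous_on UNIV (\<lambda>Y. f2 Y G H)"
  shows "f2 Z G H = f2 Z H G"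
proof (rule ccontr)
  assume ne: "f2 Z G H \<noteq> f2 Z H G"
  define \<epsilon> where "\<epsilon> = \<bar>f2 Z G H - f2 Z H G\<bar> / 2"
  have "\<epsilon> > 0" using ne by (simp add: \<epsilon>_def)
  have "\<exists>\<delta>>0. \<forall>Y. dist Y Z < \<delta> \<longrightarrow> dist (f2 Y G' H') (f2 Z G' H') < \<epsilon>" for G' H'
    using cont[of G' H'] \<open>\<epsilon> > 0\<close> unfolding continuous_on_iff by auto
  then obtain \<delta>1 \<delta>2 where d1: "\<delta>1 > 0" "\<And>Y. dist Y Z < \<delta>1 \<Longrightarrow> dist (f2 Y G H) (f2 Z G H) < \<epsilon>"
    and d2: "\<delta>2 > 0" "\<And>Y. dist Y Z < \<delta>2 \<Longrightarrow> dist (f2 Y H G) (f2 Z H G) < \<epsilon>"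
    by metis
  define K where "K = 1 + norm G + norm H"
  define t where "t = min \<delta>1 \<delta>2 / K"
  have K: "K > 0" by (simp add: K_def add_pos_nonneg)
  have t: "0 < t" "t * K = min \<delta>1 \<delta>2" using K d1(1) d2(1) by (simp_all add: t_def)
  have close: "dist (Z + a *\<^sub>R x + b *\<^sub>R y) Z < min \<delta>1 \<delta>2"
    if "0 < a" "a < t" "0 < b" "b < t" "norm x + norm y = K - 1" for a b x y
  proof -
    have "dist (Z + a *\<^sub>R x + b *\<^sub>R y) Z = norm (a *\<^sub>R x + b *\<^sub>R y)" by (simp add: dist_norm add.assoc)
    also have "\<dots> \<le> a * norm x + b * norm y" using that norm_triangle_ineq[of "a *\<^sub>R x" "b *\<^sub>R y"] by simp
    also have "\<dots> \<le> t * norm x + t * norm y" using that by (intro add_mono mult_right_mono) auto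
    also have "\<dots> = t * (K - 1)" using that(5) by (simp flip: distrib_left)
    also have "\<dots> < t * K" using t(1) by (simp add: right_diff_distrib)
    finally show ?thesis by (simp add: t(2))
  qed
  obtain s u where su: "0 < s" "s < t" "0 < u" "u < t"
    and 1: "f (Z + t *\<^sub>R G + t *\<^sub>R H) - f (Z + t *\<^sub>R G) - f (Z + t *\<^sub>R H) + f Z
      = t * t * f2 (Z + s *\<^sub>R G + u *\<^sub>R H) H G"
    using second_difference_mean_value[OF f1 f2 t(1)] by blast
  obtain s' u' where su': "0 < s'" "s' < t" "0 < u'" "u' < t"
    and 2: "f (Z + t *\<^sub>R H + t *\<^sub>R G) - f (Z + t *\<^sub>R H) - f (Z + t *\<^sub>R G) + f Z
      = t * t * f2 (Z + s' *\<^sub>R H + u' *\<^sub>R G) G H"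
    using second_difference_mean_value[OF f1 f2 t(1)] by blast
  have "t * t * f2 (Z + s *\<^sub>R G + u *\<^sub>R H) H G = t * t * f2 (Z + s' *\<^sub>R H + u' *\<^sub>R G) G H"
  proof -
    have swap: "Z + t *\<^sub>R H + t *\<^sub>R G = Z + t *\<^sub>R G + t *\<^sub>R H" by simp
    show ?thesis using 1 2[unfolded swap] by linarith
  qed
  then have eq: "f2 (Z + s *\<^sub>R G + u *\<^sub>R H) H G = f2 (Z + s' *\<^sub>R H + u' *\<^sub>R G) G H"
    using t(1) by simp
  have "dist (f2 (Z + s *\<^sub>R G + u *\<^sub>R H) H G) (f2 Z H G) < \<epsilon>"
    using close[OF su] by (intro d2(2)) (simp add: K_def)
  moreover have "dist (f2 (Z + s' *\<^sub>R H + u' *\<^sub>R G) G H) (f2 Z G H) < \<epsilon>"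
    using close[OF su'] by (intro d1(2)) (simp add: K_def)
  ultimately have "\<bar>f2 Z G H - f2 Z H G\<bar> < 2 * \<epsilon>" unfolding eq dist_real_def by linarith
  then show False by (simp add: \<epsilon>_def)
qed

lemma gradient_difference_mean_value:
  fixes h :: "'a::real_normed_vector \<Rightarrow> real"
  assumes so: "second_order_derivatives h h1 h2"
  shows "\<exists>t. 0 < t \<and> t < 1 \<and> h1 X B - h1 Y B = h2 (Y + t *\<^sub>R (X - Y)) (X - Y) B"
proof -
  have "((\<lambda>t. h1 (Y + t *\<^sub>R (X - Y)) B) has_field_derivative h2 (Y + t *\<^sub>R (X - Y)) (X - Y) B) (at t)" for t
    by (rule directional_derivative[where h' = "\<lambda>G. h2 (Y + t *\<^sub>R (X - Y)) G B"])
       (use so in \<open>simp add: second_order_derivatives_def\<close>)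
  from MVT2[of 0 1, OF _ this] show ?thesis by auto
qed

section \<open>The factored objective\<close>

lemma bounded_linear_upper: "bounded_linear (upper_block :: real^'r^('p::finite+'q::finite) \<Rightarrow> _)"
  by (rule linear_conv_bounded_linear[THEN iffD1])
     (auto intro!: linearI simp: upper_block_def vec_eq_iff)

lemma bounded_linear_lower: "bounded_linear (lower_block :: real^'r^('p::finite+'q::finite) \<Rightarrow> _)"
  by (rule linear_conv_bounded_linear[THEN iffD1])
     (auto intro!: linearI simp: lower_block_def vec_eq_iff)

lemma bounded_linear_transpose: "bounded_linear (transpose :: real^'n^'m \<Rightarrow> _)"
  by (rule linear_conv_bounded_linear[THEN iffD1, OF linear_transpose])

definition block_product :: "real^'r^('p::finite + 'q::finite) \<Rightarrow> real^'q^'p" where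
  "block_product W = upper_block W ** transpose (lower_block W)"

definition block_product_deriv ::
  "real^'r^('p::finite + 'q::finite) \<Rightarrow> real^'r^('p + 'q) \<Rightarrow> real^'q^'p" where
  "block_product_deriv W D =
     upper_block W ** transpose (lower_block D) + upper_block D ** transpose (lower_block W)"

lemma block_product_deriv_commute: "block_product_deriv W D = block_product_deriv D W"
  by (simp add: block_product_deriv_def add.commute)

lemma has_derivative_block_product: "(block_product has_derivative block_product_deriv W) (at W)"
  unfolding block_product_def[abs_def] block_product_deriv_def[abs_def]
  by (intro bounded_bilinear.FDERIV[OF bounded_bilinear_matrix_mult]
      bounded_linear.has_derivative[OF bounded_linear_transpose]
      bounded_linear_imp_has_derivative bounded_linear_upper bounded_linear_lower)

lemma linear_block_product_deriv: "linear (block_product_deriv W)"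
  by (rule has_derivative_linear[OF has_derivative_block_product])

lemma block_product_deriv_has_derivative:
  "((\<lambda>W. block_product_deriv W D) has_derivative block_product_deriv D) (at W)"
  unfolding block_product_deriv_commute[of _ D]
  by (intro bounded_linear_imp_has_derivative
      linear_conv_bounded_linear[THEN iffD1] linear_block_product_deriv)

lemma factored_objective_eq:
  "factored_objective f lam W = f (block_product W) + lam / 2 * (W \<bullet> W)"
proof -
  have "W \<bullet> W = upper_block W \<bullet> upper_block W + lower_block W \<bullet> lower_block W"
    using inner_stack[of "upper_block W" "lower_block W" "upper_block W" "lower_block W"] by simp
  then show ?thesis by (simp add: factored_objective_def block_product_def power2_norm_eq_inner)
qed

lemma factored_objective_has_derivative:
  assumes f1: "\<And>X. (f has_derivative f1 X) (at X)"
  shows "(factored_objective f lam has_derivative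
    (\<lambda>D. f1 (block_product W) (block_product_deriv W D) + lam * (W \<bullet> D))) (at W)"
proof -
  have "((\<lambda>W. f (block_product W)) has_derivative (\<lambda>D. f1 (block_product W) (block_product_deriv W D))) (at W)"
    by (rule has_derivative_compose[OF has_derivative_block_product f1])
  moreover have "((\<lambda>W. lam / 2 * (W \<bullet> W)) has_derivative (\<lambda>D. lam * (W \<bullet> D))) (at W)"
    by (auto intro!: derivative_eq_intros simp: inner_commute)
  ultimately show ?thesis
    unfolding factored_objective_eq[abs_def] by (rule has_derivative_add)
qed

text \<open>
  The factored objective contains \<open>f\<close> composed with a bilinear map. Its second derivative therefore has
  the gradient term \<open>f1 (block_product W) (block_product_deriv G D)\<close>, through which negative curvature
  can arise even for convex \<open>f\<close>.
\<close>
lemma twice_continuously_differentiable_second_order: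
  fixes f :: "real^'q^'p \<Rightarrow> real"
  assumes "twice_continuously_differentiable f"
  obtains f1 f2 where "second_order_derivatives f f1 f2"
    "\<And>lam. second_order_derivatives (factored_objective f lam :: real^'r^('p::finite + 'q::finite) \<Rightarrow> real)
      (\<lambda>W D. f1 (block_product W) (block_product_deriv W D) + lam * (W \<bullet> D))
      (\<lambda>W G D. f2 (block_product W) (block_product_deriv W G) (block_product_deriv W D)
         + f1 (block_product W) (block_product_deriv G D) + lam * (G \<bullet> D))"
proof -
  obtain F :: "real^'q^'p \<Rightarrow> (real^'q^'p) \<Rightarrow>\<^sub>L real" and F2 where
    F: "\<And>Z. (f has_derivative blinfun_apply (F Z)) (at Z)"
    and F2: "\<And>Z. (F has_derivative blinfun_apply (F2 Z)) (at Z)"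
    and cont: "continuous_on UNIV F2"
    using assms unfolding twice_continuously_differentiable_def by blast
  define f1 where "f1 Z D = F Z D" for Z D
  define f2 where "f2 Z G D = F2 Z G D" for Z G D
  have f1: "(f has_derivative f1 Z) (at Z)" for Z
    using F[of Z] by (simp add: f1_def[abs_def])
  have f2: "((\<lambda>Y. f1 Y D) has_derivative (\<lambda>G. f2 Z G D)) (at Z)" for Z D
    unfolding f1_def f2_def by (rule bounded_linear.has_derivative[OF blinfun.bounded_linear_left F2])
  have lin1: "linear (f1 Z)" for Z
    using has_derivative_linear[OF f1] .
  have lin2: "linear (f2 Z G)" for Z G
    by (auto intro!: linearI simp: f2_def blinfun.add_right blinfun.scaleR_right)
  have "continuous_on UNIV (\<lambda>Y. f2 Y G H)" for G H
    unfolding f2_def by (intro continuous_intros cont)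
  then have sym: "f2 Z G H = f2 Z H G" for Z G H
    by (rule second_derivative_symmetric[OF f1 f2])
  show thesis
  proof (rule that)
    show "second_order_derivatives f f1 f2"
      using f1 f2 lin2 sym by (simp add: second_order_derivatives_def)
    fix lam
    let ?g1 = "\<lambda>W D. f1 (block_product W) (block_product_deriv W D) + lam * (W \<bullet> D)"
    let ?g2 = "\<lambda>W G D. f2 (block_product W) (block_product_deriv W G) (block_product_deriv W D)
         + f1 (block_product W) (block_product_deriv G D) + lam * (G \<bullet> D)"
    have "((\<lambda>Y. ?g1 Y D) has_derivative (\<lambda>G. ?g2 W G D)) (at W)" for W D :: "real^'r^('p + 'q)"
    proof -
      have "((\<lambda>Y. F (block_product Y)) has_derivative
          (\<lambda>G. F2 (block_product W) (block_product_deriv W G))) (at W)"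
        by (rule has_derivative_compose[OF has_derivative_block_product F2])
      from blinfun.FDERIV[OF this block_product_deriv_has_derivative]
      have "((\<lambda>Y. f1 (block_product Y) (block_product_deriv Y D)) has_derivative
          (\<lambda>G. f1 (block_product W) (block_product_deriv D G)
             + f2 (block_product W) (block_product_deriv W G) (block_product_deriv W D))) (at W)"
        by (simp add: f1_def f2_def)
      moreover have "((\<lambda>Y. lam * (Y \<bullet> D)) has_derivative (\<lambda>G. lam * (G \<bullet> D))) (at W)"
        by (auto intro!: derivative_eq_intros)
      ultimately have "((\<lambda>Y. ?g1 Y D) has_derivative
          (\<lambda>G. (f1 (block_product W) (block_product_deriv D G)
             + f2 (block_product W) (block_product_deriv W G) (block_product_deriv W D)) + lam * (G \<bullet> D))) (at W)"
        by (rule has_derivative_add)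
      then show ?thesis by (simp add: block_product_deriv_commute[of D] add.commute)
    qed
    moreover have "linear (?g2 W G)" for W G :: "real^'r^('p + 'q)"
      by (rule linearI)
        (simp_all add: linear_add[OF linear_block_product_deriv] linear_add[OF lin1] linear_add[OF lin2]
          linear_scale[OF linear_block_product_deriv] linear_scale[OF lin1] linear_scale[OF lin2]
          inner_add_right algebra_simps)
    ultimately show "second_order_derivatives (factored_objective f lam :: real^'r^('p + 'q) \<Rightarrow> real) ?g1 ?g2"
      unfolding second_order_derivatives_def
    proof (intro conjI allI)
      fix W G D :: "real^'r^('p + 'q)"
      show "(factored_objective f lam has_derivative ?g1 W) (at W)"
        by (rule factored_objective_has_derivative[OF f1])
      show "?g2 W G D = ?g2 W D G"
        by (simp only: sym[of "block_product W" "block_product_deriv W G"]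
            block_product_deriv_commute[of G] inner_commute[of G])
    qed blast+
  qed
qed

section \<open>Rank\<close>

lemma rank_add_le: "rank (A + B) \<le> rank A + rank (B :: real^'n^'m)"
proof -
  let ?R = "\<lambda>C::real^'n^'m. range ((*v) C)"
  have sub: "subspace (?R C)" for C by (simp add: linear_subspace_image)
  have "?R (A + B) \<subseteq> {x + y |x y. x \<in> ?R A \<and> y \<in> ?R B}"
    by (auto simp: matrix_vector_mult_add_rdistrib)
  then have "dim (?R (A + B)) \<le> dim {x + y |x y. x \<in> ?R A \<and> y \<in> ?R B}"
    by (rule dim_subset)
  also have "\<dots> \<le> dim (?R A) + dim (?R B)"
    using dim_sums_Int[OF sub sub, of A B] by linarith
  finally show ?thesis by (simp add: rank_dim_range)
qed

lemma rank_scaleR_le: "rank (c *\<^sub>R A) \<le> rank (A :: real^'n^'m)"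
proof -
  have "c *\<^sub>R A = mat c ** A"
    by (simp add: vec_eq_iff matrix_matrix_mult_def mat_def if_distrib[of "\<lambda>x. x * _"] cong: if_cong)
  then show ?thesis by (simp add: rank_mul_le_right)
qed

lemma rank_diff_le: "rank (A - B) \<le> rank A + rank (B :: real^'n^'m)"
  using rank_add_le[of A "(-1) *\<^sub>R B"] rank_scaleR_le[of "-1" B] by simp

lemma rank_factored: "rank ((U :: real^'r^'m) ** (V :: real^'n^'r)) \<le> CARD('r)"
  using rank_mul_le_left[of U V] rank_bound[of U] by simp

section \<open>Critical points and the convex optimum\<close>

lemma block_of_mult:
  "upper_block (W ** K) = upper_block W ** K" "lower_block (W ** K) = lower_block W ** K"
  using stack_mult[of "upper_block W" "lower_block W" K] by (metis stack_blocks)+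

lemma block_of_diff:
  "upper_block (W - Y) = upper_block W - upper_block Y" "lower_block (W - Y) = lower_block W - lower_block Y"
  by (simp_all add: upper_block_def lower_block_def vec_eq_iff)

lemma norm_stack: "(norm (stack U V))\<^sup>2 = (norm U)\<^sup>2 + (norm V)\<^sup>2"
  by (simp add: power2_norm_eq_inner inner_stack)

lemma block_product_deriv_self: "block_product_deriv W W = 2 *\<^sub>R block_product W"
  by (simp add: block_product_deriv_def block_product_def scaleR_2)

lemma block_product_deriv_mult_transpose:
  "block_product_deriv W (Y ** transpose K) = block_product_deriv Y (W ** K)"
  by (simp add: block_product_deriv_def block_of_mult matrix_transpose_mul matrix_mul_assoc add.commute)

text \<open>
  The direction that multiplies the upper block by \<open>K\<close> and the lower block by \<open>- K\<^sup>T\<close> leaves the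
  product unchanged to first order. Stationarity in these directions concerns the regularizer alone.
\<close>
lemma stationary_imp_balanced:
  fixes W :: "real^'r^('p::finite + 'q::finite)"
  assumes "linear L" and "lam \<noteq> 0"
    and stat: "\<And>D. L (block_product_deriv W D) + lam * (W \<bullet> D) = 0"
  shows "transpose (upper_block W) ** upper_block W = transpose (lower_block W) ** lower_block W"
proof -
  define U where "U = upper_block W"
  define V where "V = lower_block W"
  have W: "W = stack U V" by (simp add: U_def V_def)
  have "(transpose U ** U) \<bullet> K = (transpose V ** V) \<bullet> K" for K
  proof -
    define D where "D = stack (U ** K) (- (V ** transpose K))"
    have "block_product_deriv W D = 0"
      by (simp add: W D_def block_product_deriv_def transpose_distribs matrix_transpose_mul
          matrix_mult_distribs matrix_mul_assoc)
    then have "W \<bullet> D = 0" using stat[of D] \<open>lam \<noteq> 0\<close> linear_0[OF \<open>linear L\<close>] by simp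
    then have "U \<bullet> (U ** K) = V \<bullet> (V ** transpose K)" by (simp add: W D_def inner_stack)
    moreover have "U \<bullet> (U ** K) = (transpose U ** U) \<bullet> K"
      by (metis inner_commute inner_matrix_mult_right)
    moreover have "V \<bullet> (V ** transpose K) = (transpose V ** V) \<bullet> transpose K"
      by (metis inner_commute inner_matrix_mult_right)
    moreover have "(transpose V ** V) \<bullet> transpose K = (transpose V ** V) \<bullet> K"
      using inner_transpose[of "transpose V ** V" K] by (simp add: symmetric_gram)
    ultimately show ?thesis by simp
  qed
  then show ?thesis unfolding U_def[symmetric] V_def[symmetric]
    using vector_eq_rdot by blast
qed

text \<open>
  A form between \<open>m\<close> and \<open>M\<close> times the squared norm is close to \<open>(m + M) / 2\<close> times the inner product.
  By polarization it is enough to know the lower bound at the sum and the upper bound at the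
  difference of \<open>A\<close> and \<open>B\<close>, scaled to equal norm. This makes the estimate available for a form that
  is well-conditioned only on matrices of low rank.
\<close>
lemma well_conditioned_almost_orthogonality:
  fixes q :: "'a::real_inner \<Rightarrow> 'a \<Rightarrow> real"
  assumes lin: "\<And>x. linear (q x)" and sym: "\<And>x y. q x y = q y x"
    and lower: "m * (norm (norm B *\<^sub>R A + norm A *\<^sub>R B))\<^sup>2
      \<le> q (norm B *\<^sub>R A + norm A *\<^sub>R B) (norm B *\<^sub>R A + norm A *\<^sub>R B)"
    and upper: "q (norm B *\<^sub>R A - norm A *\<^sub>R B) (norm B *\<^sub>R A - norm A *\<^sub>R B)
      \<le> M * (norm (norm B *\<^sub>R A - norm A *\<^sub>R B))\<^sup>2"
  shows "(m + M) * (A \<bullet> B) - 2 * q A B \<le> (M - m) * (norm A * norm B)"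
proof (cases "A = 0 \<or> B = 0")
  case True
  have "q 0 x = 0" "q x 0 = 0" for x
    using linear_0[OF lin[of x]] sym[of x 0] by auto
  with True show ?thesis by auto
next
  case False
  define a where "a = norm A"
  define b where "b = norm B"
  have pos: "a * b > 0" using False by (simp add: a_def b_def)
  have lin2: "linear (\<lambda>x. q x y)" for y using lin[of y] by (simp add: sym[of _ y])
  note simps = linear_add[OF lin] linear_diff[OF lin] linear_scale[OF lin]
    linear_add[OF lin2] linear_diff[OF lin2] linear_scale[OF lin2]
  have AA: "A \<bullet> A = a * a" and BB: "B \<bullet> B = b * b"
    by (simp_all add: a_def b_def power2_norm_eq_inner[symmetric] power2_eq_square)
  have "q (b *\<^sub>R A + a *\<^sub>R B) (b *\<^sub>R A + a *\<^sub>R B) - q (b *\<^sub>R A - a *\<^sub>R B) (b *\<^sub>R A - a *\<^sub>R B)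
      = 4 * (a * b) * q A B"
    by (simp add: simps sym[of B A] algebra_simps)
  moreover have "(norm (b *\<^sub>R A + a *\<^sub>R B))\<^sup>2 = 2 * (a * b) * (a * b + A \<bullet> B)"
    by (simp add: power2_norm_eq_inner inner_add_left inner_add_right AA BB inner_commute[of B A] algebra_simps)
  moreover have "(norm (b *\<^sub>R A - a *\<^sub>R B))\<^sup>2 = 2 * (a * b) * (a * b - A \<bullet> B)"
    by (simp add: power2_norm_eq_inner inner_diff_left inner_diff_right AA BB inner_commute[of B A] algebra_simps)
  moreover have "m * (norm (b *\<^sub>R A + a *\<^sub>R B))\<^sup>2 - M * (norm (b *\<^sub>R A - a *\<^sub>R B))\<^sup>2
      \<le> q (b *\<^sub>R A + a *\<^sub>R B) (b *\<^sub>R A + a *\<^sub>R B) - q (b *\<^sub>R A - a *\<^sub>R B) (b *\<^sub>R A - a *\<^sub>R B)"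
    using lower upper unfolding a_def b_def by linarith
  ultimately have "m * (2 * (a * b) * (a * b + A \<bullet> B)) - M * (2 * (a * b) * (a * b - A \<bullet> B))
      \<le> 4 * (a * b) * q A B"
    by (simp only:)
  then have "(2 * (a * b)) * (m * (a * b + A \<bullet> B) - M * (a * b - A \<bullet> B)) \<le> (2 * (a * b)) * (2 * q A B)"
    by (simp add: algebra_simps)
  then have "m * (a * b + A \<bullet> B) - M * (a * b - A \<bullet> B) \<le> 2 * q A B"
    by (rule mult_left_le_imp_le) (use pos in simp)
  then show ?thesis by (simp add: a_def b_def algebra_simps)
qed

lemma nuclear_norm_factored_le:
  fixes U :: "real^'r^'p" and V :: "real^'r^'q"
  shows "nuclear_norm (U ** transpose V) \<le> ((norm U)\<^sup>2 + (norm V)\<^sup>2) / 2"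
proof -
  obtain T where T: "(U ** transpose V) \<bullet> T = nuclear_norm (U ** transpose V)"
    "\<And>x. norm (T *v x) \<le> norm x" using nuclear_norm_dual[of "U ** transpose V"] by blast
  show ?thesis using contraction_inner_product_le[OF T(2), of U V] T(1) by simp
qed

lemma nuclear_norm_perturbation:
  fixes X :: "real^'q^'p" and U :: "real^'r^'p" and V :: "real^'r^'q"
  assumes "rank X \<le> CARD('r)" "0 \<le> t"
  shows "nuclear_norm (X + t *\<^sub>R (U ** transpose V))
    \<le> nuclear_norm X + t * (((norm U)\<^sup>2 + (norm V)\<^sup>2) / 2)"
proof -
  let ?X' = "X + t *\<^sub>R (U ** transpose V)"
  obtain T where T: "?X' \<bullet> T = nuclear_norm ?X'" "\<And>x. norm (T *v x) \<le> norm x"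
    using nuclear_norm_dual[of ?X'] by blast
  obtain U0 :: "real^'r^'p" and V0 :: "real^'r^'q" and d where
    "U0 ** transpose V0 = X" "transpose U0 ** U0 = diag d" "transpose V0 ** V0 = diag d"
    "sum d UNIV = nuclear_norm X"
    using balanced_svd_factorization[OF assms(1)] by metis
  then have "X \<bullet> T \<le> nuclear_norm X"
    using contraction_inner_product_le[OF T(2), of U0 V0] by (simp add: norm_gram_diag)
  moreover have "t * ((U ** transpose V) \<bullet> T) \<le> t * (((norm U)\<^sup>2 + (norm V)\<^sup>2) / 2)"
    using assms(2) by (intro mult_left_mono contraction_inner_product_le T(2))
  ultimately show ?thesis using T(1) by (simp add: inner_add_left)
qed

text \<open>
  The factored objective dominates the convex objective and agrees with it at the balanced factor
  \<open>Y\<close> of the optimum. Hence \<open>Y\<close> is a global minimizer and therefore stationary. The last inequality is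
  the one-sided derivative at \<open>t = 0\<close> of the optimality condition along \<open>X + t U V\<^sup>T\<close>; it says that the
  spectral norm of the gradient of \<open>f\<close> at \<open>X\<close> is at most \<open>lam\<close>.
\<close>
lemma convex_optimal_factor:
  fixes X :: "real^'q^'p"
  assumes f1: "\<And>X. (f has_derivative f1 X) (at X)"
    and opt: "convex_optimal f lam X" and "lam > 0" and rank: "rank X \<le> CARD('r)"
  obtains Y :: "real^'r^('p::finite + 'q::finite)" and d where
    "block_product Y = X" "transpose Y ** Y = diag d"
    "\<And>j. 0 \<le> d j" "\<And>j. d j \<noteq> 0 \<Longrightarrow> 2 * rho X \<le> d j"
    "\<And>j. rank X = CARD('r) \<Longrightarrow> d j \<noteq> 0"
    "\<And>D. f1 X (block_product_deriv Y D) + lam * (Y \<bullet> D) = 0"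
    "\<And>W :: real^'r^('p + 'q). 0 \<le> f1 X (block_product W) + lam / 2 * (W \<bullet> W)"
proof -
  obtain U :: "real^'r^'p" and V :: "real^'r^'q" and d where
    UV: "U ** transpose V = X" and UU: "transpose U ** U = diag d" and VV: "transpose V ** V = diag d"
    and d: "\<And>j. 0 \<le> d j" "\<And>j. d j \<noteq> 0 \<Longrightarrow> rho X \<le> d j"
    and sum: "sum d UNIV = nuclear_norm X" and full: "\<And>j. rank X = CARD('r) \<Longrightarrow> d j \<noteq> 0"
    by (rule balanced_svd_factorization[OF rank]) blast
  define Y where "Y = stack U V"
  have YX: "block_product Y = X" by (simp add: Y_def block_product_def UV)
  have YY: "Y \<bullet> Y = 2 * nuclear_norm X"
    using norm_gram_diag[OF UU] norm_gram_diag[OF VV]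
    by (simp add: Y_def inner_stack power2_norm_eq_inner sum)
  have inner: "((norm (upper_block W))\<^sup>2 + (norm (lower_block W))\<^sup>2) / 2 = (W \<bullet> W) / 2"
    for W :: "real^'r^('p + 'q)"
    using norm_stack[of "upper_block W" "lower_block W"] by (simp add: power2_norm_eq_inner)
  have global_min: "factored_objective f lam Y \<le> factored_objective f lam W" for W :: "real^'r^('p + 'q)"
  proof -
    have "nuclear_norm (block_product W) \<le> (W \<bullet> W) / 2"
      using nuclear_norm_factored_le[of "upper_block W" "lower_block W"]
      by (simp add: block_product_def inner)
    then have "lam * nuclear_norm (block_product W) \<le> lam * ((W \<bullet> W) / 2)"
      using \<open>lam > 0\<close> by (intro mult_left_mono) auto
    moreover have "f X + lam * nuclear_norm X \<le> f (block_product W) + lam * nuclear_norm (block_product W)"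
      using opt by (simp add: convex_optimal_def)
    ultimately show ?thesis by (simp add: factored_objective_eq YX YY)
  qed
  have stat: "f1 X (block_product_deriv Y D) + lam * (Y \<bullet> D) = 0" for D
    using has_derivative_local_min[OF factored_objective_has_derivative[OF f1, of lam Y]] global_min
    by (simp add: YX fun_eq_iff)
  have dual: "0 \<le> f1 X (block_product W) + lam / 2 * (W \<bullet> W)" for W :: "real^'r^('p + 'q)"
  proof (rule ccontr)
    assume neg: "\<not> ?thesis"
    define \<phi> where "\<phi> t = f (X + t *\<^sub>R block_product W) + t * (lam / 2 * (W \<bullet> W))" for t
    have "((\<lambda>t. f (X + t *\<^sub>R block_product W)) has_field_derivative f1 X (block_product W)) (at 0)"
      by (rule directional_derivative) (simp add: f1)
    then have "(\<phi> has_field_derivative (f1 X (block_product W) + 1 * (lam / 2 * (W \<bullet> W)))) (at 0)"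
      unfolding \<phi>_def by (intro DERIV_add DERIV_cmult_right DERIV_ident)
    then obtain \<delta> where \<delta>: "\<delta> > 0" "\<And>t. 0 < t \<Longrightarrow> t < \<delta> \<Longrightarrow> \<phi> (0 + t) < \<phi> 0"
      using DERIV_neg_dec_right[of \<phi>] neg by (metis mult_1 not_le)
    define t where "t = \<delta> / 2"
    have t: "0 < t" "t < \<delta>" using \<delta>(1) by (simp_all add: t_def)
    have "nuclear_norm (X + t *\<^sub>R block_product W) \<le> nuclear_norm X + t * ((W \<bullet> W) / 2)"
      using nuclear_norm_perturbation[OF rank, of t "upper_block W" "lower_block W"] t
      by (simp add: block_product_def inner)
    then have "lam * nuclear_norm (X + t *\<^sub>R block_product W) \<le> lam * (nuclear_norm X + t * ((W \<bullet> W) / 2))"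
      using \<open>lam > 0\<close> by (intro mult_left_mono) auto
    moreover have "f X + lam * nuclear_norm X
        \<le> f (X + t *\<^sub>R block_product W) + lam * nuclear_norm (X + t *\<^sub>R block_product W)"
      using opt by (simp add: convex_optimal_def)
    ultimately have "\<phi> 0 \<le> \<phi> t" by (simp add: \<phi>_def algebra_simps)
    then show False using \<delta>(2)[OF t] by simp
  qed
  have "transpose Y ** Y = diag (\<lambda>j. 2 * d j)"
    unfolding Y_def stack_gram UU VV by (simp add: diag_def vec_eq_iff)
  then show thesis
    by (rule that[OF YX _ _ _ _ stat dual]) (use d full in auto)
qed

section \<open>A direction of negative curvature\<close>

text \<open>
  Both stationarity conditions enter in two ways. Tested with \<open>W\<close> and \<open>Y\<close>, they turn the part of the
  Hessian form that is linear in the gradient into a difference of gradients at the two products,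
  where strong convexity applies. Tested with the projected residual \<open>Z = W - Y K\<^sup>T\<close>, they show that the
  difference of gradients is nonpositive in the direction induced by \<open>Z\<close>, while the near-orthogonality
  of the Hessian of \<open>f\<close> would make it positive unless \<open>\<parallel>Z W\<^sup>T\<parallel>\<close> is small
  compared with the distance of the products.
\<close>
lemma hessian_descent_direction:
  fixes f :: "real^'q^'p \<Rightarrow> real" and W Y :: "real^'r^('p::finite + 'q::finite)"
  assumes so: "second_order_derivatives f f1 f2"
    and wc: "\<And>Z D. rank Z \<le> 2 * CARD('r) \<Longrightarrow> rank D \<le> 4 * CARD('r) \<Longrightarrow>
      m * (norm D)\<^sup>2 \<le> f2 Z D D \<and> f2 Z D D \<le> M * (norm D)\<^sup>2"
    and Mm: "M \<le> 1.5 * m" and "0 < m" "0 < M" and "lam > 0"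
    and critW: "\<And>D. f1 (block_product W) (block_product_deriv W D) + lam * (W \<bullet> D) = 0"
    and critY: "\<And>D. f1 (block_product Y) (block_product_deriv Y D) + lam * (Y \<bullet> D) = 0"
    and dual: "\<And>W :: real^'r^('p + 'q). 0 \<le> f1 (block_product Y) (block_product W) + lam / 2 * (W \<bullet> W)"
    and sym: "transpose (transpose W ** Y) = transpose W ** Y"
    and psd: "\<And>x. 0 \<le> x \<bullet> ((transpose W ** Y) *v x)"
  defines "D \<equiv> W - Y"
  shows "f2 (block_product W) (block_product_deriv W D) (block_product_deriv W D)
      + f1 (block_product W) (block_product_deriv D D) + lam * (D \<bullet> D)
    \<le> - 0.41 * m * (norm (block_product W - block_product Y))\<^sup>2"
    and "(norm (W ** transpose W - Y ** transpose Y))\<^sup>2 \<le> 4 * (norm (block_product W - block_product Y))\<^sup>2"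
proof -
  define X where "X = block_product W"
  define X' where "X' = block_product Y"
  define H where "H = X - X'"
  let ?B = "block_product_deriv"
  have lin1: "linear (f1 Z)" for Z
    using so has_derivative_linear unfolding second_order_derivatives_def by blast
  have lin2: "linear (f2 Z G)" and sym2: "f2 Z G D' = f2 Z D' G" for Z G D'
    using so by (auto simp: second_order_derivatives_def)
  have balW: "transpose (upper_block W) ** upper_block W = transpose (lower_block W) ** lower_block W"
    using \<open>lam > 0\<close> by (intro stationary_imp_balanced[OF lin1 _ critW]) simp
  have balY: "transpose (upper_block Y) ** upper_block Y = transpose (lower_block Y) ** lower_block Y"
    using \<open>lam > 0\<close> by (intro stationary_imp_balanced[OF lin1 _ critY]) simp
  show gap: "(norm (W ** transpose W - Y ** transpose Y))\<^sup>2 \<le> 4 * (norm (block_product W - block_product Y))\<^sup>2"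
    using stacked_difference_le_product_difference[OF balW balY] by (simp add: block_product_def)
  have rankX: "rank X \<le> CARD('r)" and rankX': "rank X' \<le> CARD('r)"
    by (simp_all add: X_def X'_def block_product_def rank_factored)
  have rank_seg: "rank (X' + t *\<^sub>R H) \<le> 2 * CARD('r)" for t
  proof -
    have "X' + t *\<^sub>R H = (1 - t) *\<^sub>R X' + t *\<^sub>R X" by (simp add: H_def algebra_simps)
    then show ?thesis
      using rank_add_le[of "(1 - t) *\<^sub>R X'" "t *\<^sub>R X"] rank_scaleR_le[of "1 - t" X']
        rank_scaleR_le[of t X] rankX rankX' by simp
  qed
  have rankH: "rank H \<le> 2 * CARD('r)"
    using rank_diff_le[of X X'] rankX rankX' by (simp add: H_def)
  have rankB: "rank (?B W G) \<le> 2 * CARD('r)" for G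
    using rank_add_le[of "upper_block W ** transpose (lower_block G)" "upper_block G ** transpose (lower_block W)"]
      rank_factored[of "upper_block W" "transpose (lower_block G)"]
      rank_factored[of "upper_block G" "transpose (lower_block W)"]
    by (simp add: block_product_deriv_def)
  have normB: "(norm (?B W G))\<^sup>2 \<le> (norm (G ** transpose W))\<^sup>2" for G
    using product_derivative_norm_le[OF balW, of "upper_block G" "lower_block G"]
    by (simp add: block_product_deriv_def add.commute)

  (* The form D \<mapsto> f1 X (?B D D) + lam * (D \<bullet> D) is quadratic and W lies in its kernel, so only the
     contribution of Y remains. *)
  have linear_part: "f1 X (?B D D) + lam * (D \<bullet> D) \<le> - 2 * m * (norm H)\<^sup>2"
  proof -
    have "?B D D = ?B W W - 2 *\<^sub>R ?B W Y + ?B Y Y"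
      by (simp add: D_def linear_diff[OF linear_block_product_deriv] scaleR_2
          block_product_deriv_commute[of "W - Y"] block_product_deriv_commute[of Y W])
    then have "f1 X (?B D D) = f1 X (?B W W) - 2 * f1 X (?B W Y) + 2 * f1 X X'"
      by (simp add: linear_add[OF lin1] linear_diff[OF lin1] linear_scale[OF lin1]
          block_product_deriv_self[of Y] X'_def)
    moreover have "lam * (D \<bullet> D) = lam * (W \<bullet> W) - 2 * (lam * (W \<bullet> Y)) + lam * (Y \<bullet> Y)"
      by (simp add: D_def inner_diff_left inner_diff_right inner_commute[of Y W] algebra_simps)
    moreover have "f1 X (?B W W) + lam * (W \<bullet> W) = 0" "f1 X (?B W Y) + lam * (W \<bullet> Y) = 0"
      using critW by (simp_all add: X_def)
    moreover have "2 * f1 X' X' + lam * (Y \<bullet> Y) = 0"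
      using critY[of Y] by (simp add: X'_def block_product_deriv_self linear_scale[OF lin1])
    moreover have "2 * f1 X X + lam * (W \<bullet> W) = 0"
      using critW[of W] by (simp add: X_def block_product_deriv_self linear_scale[OF lin1])
    moreover have "0 \<le> f1 X' X + lam / 2 * (W \<bullet> W)"
      using dual[of W] by (simp add: X_def X'_def)
    ultimately have "f1 X (?B D D) + lam * (D \<bullet> D) \<le> - 2 * (f1 X H - f1 X' H)"
      by (simp add: H_def linear_diff[OF lin1] algebra_simps)
    moreover obtain t where "f1 X H - f1 X' H = f2 (X' + t *\<^sub>R H) H H"
      using gradient_difference_mean_value[OF so, of X H X'] unfolding H_def by blast
    moreover have "m * (norm H)\<^sup>2 \<le> f2 (X' + t *\<^sub>R H) H H"
      using wc[OF rank_seg[of t], of H] rankH by simp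
    ultimately show ?thesis by argo
  qed

  obtain K where K: "transpose W ** W ** K = transpose W ** Y"
    using normal_equations_solvable by blast
  define Z where "Z = W - Y ** transpose K"
  define n where "n = norm (Z ** transpose W)"
  have n_le: "n\<^sup>2 \<le> 4/25 * (norm H)\<^sup>2"
  proof -
    have inner_ge: "1/2 * n\<^sup>2 \<le> H \<bullet> ?B W Z"
      using residual_norm_le_inner[OF balW balY, of K] sym K
      by (simp add: n_def Z_def H_def X_def X'_def block_product_def block_product_deriv_def
          block_of_mult block_of_diff add.commute)
    have "norm (?B W Z) \<le> n"
      using normB[of Z] unfolding n_def by (rule power2_le_imp_le) simp
    (* Z = W - Y K\<^sup>T: the dual inequality handles the part W. The perturbation of W by Y K\<^sup>T
       changes the product exactly as that of Y by W K does, and Y is stationary. *)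
    have decrease: "f1 X (?B W Z) - f1 X' (?B W Z) \<le> 0"
    proof -
      have "f1 X' (?B Y (W ** K)) + lam * (Y \<bullet> (W ** K)) = 0" using critY by (simp add: X'_def)
      moreover have "Y \<bullet> (W ** K) = W \<bullet> (Y ** transpose K)"
        by (metis inner_commute inner_matrix_mult_left)
      moreover have "0 \<le> 2 * f1 X' X + lam * (W \<bullet> W)" using dual[of W] by (simp add: X_def X'_def)
      moreover have "f1 X' (?B W Z) = 2 * f1 X' X - f1 X' (?B Y (W ** K))"
        by (simp add: Z_def linear_diff[OF linear_block_product_deriv] linear_diff[OF lin1]
            linear_scale[OF lin1] block_product_deriv_self block_product_deriv_mult_transpose X_def)
      moreover have "f1 X (?B W Z) + lam * (W \<bullet> Z) = 0" using critW by (simp add: X_def)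
      ultimately show ?thesis by (simp add: Z_def inner_diff_right algebra_simps)
    qed
    obtain t where t: "f1 X (?B W Z) - f1 X' (?B W Z) = f2 (X' + t *\<^sub>R H) H (?B W Z)"
      using gradient_difference_mean_value[OF so, of X "?B W Z" X'] unfolding H_def by blast
    have "(m + M) * (H \<bullet> ?B W Z) - 2 * f2 (X' + t *\<^sub>R H) H (?B W Z) \<le> (M - m) * (norm H * norm (?B W Z))"
    proof (rule well_conditioned_almost_orthogonality[OF lin2 sym2])
      have rk: "rank (a *\<^sub>R H) \<le> 2 * CARD('r)" "rank (a *\<^sub>R ?B W Z) \<le> 2 * CARD('r)" for a
        using rank_scaleR_le[of a H] rank_scaleR_le[of a "?B W Z"] rankH rankB[of Z] by linarith+
      have "rank (a *\<^sub>R H + b *\<^sub>R ?B W Z) \<le> 4 * CARD('r)" "rank (a *\<^sub>R H - b *\<^sub>R ?B W Z) \<le> 4 * CARD('r)" for a b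
        using rank_add_le[of "a *\<^sub>R H" "b *\<^sub>R ?B W Z"] rank_diff_le[of "a *\<^sub>R H" "b *\<^sub>R ?B W Z"] rk[of a] rk[of b]
        by linarith+
      note wc[OF rank_seg[of t] this(1)] wc[OF rank_seg[of t] this(2)]
      then show
        "m * (norm (norm (?B W Z) *\<^sub>R H + norm H *\<^sub>R ?B W Z))\<^sup>2
        \<le> f2 (X' + t *\<^sub>R H) (norm (?B W Z) *\<^sub>R H + norm H *\<^sub>R ?B W Z) (norm (?B W Z) *\<^sub>R H + norm H *\<^sub>R ?B W Z)"
        "f2 (X' + t *\<^sub>R H) (norm (?B W Z) *\<^sub>R H - norm H *\<^sub>R ?B W Z) (norm (?B W Z) *\<^sub>R H - norm H *\<^sub>R ?B W Z)
        \<le> M * (norm (norm (?B W Z) *\<^sub>R H - norm H *\<^sub>R ?B W Z))\<^sup>2"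
        by blast+
    qed
    then have "(m + M) * (H \<bullet> ?B W Z) \<le> (M - m) * (norm H * norm (?B W Z))"
      using decrease t by linarith
    also have "\<dots> \<le> ((m + M) / 5) * (norm H * norm (?B W Z))"
      using Mm by (intro mult_right_mono) auto
    also have "\<dots> \<le> ((m + M) / 5) * (norm H * n)"
      using \<open>norm (?B W Z) \<le> n\<close> \<open>0 < m\<close> \<open>0 < M\<close> by (intro mult_left_mono) auto
    also have "\<dots> = (m + M) * (norm H * n / 5)" by simp
    finally have "H \<bullet> ?B W Z \<le> norm H * n / 5"
      by (rule mult_left_le_imp_le) (use \<open>0 < m\<close> \<open>0 < M\<close> in simp)
    with inner_ge have "n * n \<le> n * (0.4 * norm H)" by (simp add: power2_eq_square mult_ac)
    moreover have "0 \<le> n" by (simp add: n_def)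
    ultimately have "n \<le> 0.4 * norm H" by (cases "n = 0") auto
    then have "n\<^sup>2 \<le> (0.4 * norm H)\<^sup>2" using \<open>0 \<le> n\<close> by (rule power_mono)
    then show ?thesis by (simp add: power_mult_distrib power2_eq_square)
  qed

  have "(norm (D ** transpose W))\<^sup>2 \<le> 1/8 * (norm (W ** transpose W - Y ** transpose Y))\<^sup>2 + 7/2 * n\<^sup>2"
    using difference_times_factor_bound[OF sym psd K] by (simp add: D_def n_def Z_def)
  then have "(norm (?B W D))\<^sup>2 \<le> 53/50 * (norm H)\<^sup>2"
    using normB[of D] gap n_le unfolding H_def X_def X'_def by linarith
  then have "M * (norm (?B W D))\<^sup>2 \<le> M * (53/50 * (norm H)\<^sup>2)"
    using \<open>0 < M\<close> by (intro mult_left_mono) auto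
  also have "\<dots> \<le> (1.5 * m) * (53/50 * (norm H)\<^sup>2)"
    using Mm by (intro mult_right_mono) auto
  finally have "f2 X (?B W D) (?B W D) \<le> 159/100 * m * (norm H)\<^sup>2"
    using wc[of X "?B W D"] rankX rankB[of D] by simp
  with linear_part
  show "f2 (block_product W) (?B W D) (?B W D) + f1 (block_product W) (?B D D) + lam * (D \<bullet> D)
    \<le> - 0.41 * m * (norm (block_product W - block_product Y))\<^sup>2"
    by (simp add: X_def[symmetric] X'_def[symmetric] H_def[symmetric])
qed

section \<open>The strict saddle property\<close>

lemma gram_diag_bounds:
  fixes Y :: "real^'r^'n"
  assumes YY: "transpose Y ** Y = diag d" and d: "\<And>j. 0 \<le> d j" "\<And>j. d j \<noteq> 0 \<Longrightarrow> c \<le> d j"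
  shows "c * (norm (Y *v x))\<^sup>2 \<le> (norm ((transpose Y ** Y) *v x))\<^sup>2"
    and "(\<And>j. d j \<noteq> 0) \<Longrightarrow> c * (norm x)\<^sup>2 \<le> (norm (Y *v x))\<^sup>2"
proof -
  have Yx: "(norm (Y *v x))\<^sup>2 = (\<Sum>j\<in>UNIV. d j * (x $ j)\<^sup>2)"
    using gram_form[of x Y Y x]
    by (simp add: YY diag_mult_vector inner_vec_def power2_norm_eq_inner)
       (simp add: power2_eq_square mult_ac)
  have YYx: "(norm ((transpose Y ** Y) *v x))\<^sup>2 = (\<Sum>j\<in>UNIV. (d j * x $ j)\<^sup>2)"
    by (simp add: YY diag_mult_vector norm_vec_def L2_set_def sum_nonneg)
  have x: "(norm x)\<^sup>2 = (\<Sum>j\<in>UNIV. (x $ j)\<^sup>2)" by (simp add: norm_vec_def L2_set_def sum_nonneg)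
  have "c * (d j * (x $ j)\<^sup>2) \<le> (d j * x $ j)\<^sup>2" for j
  proof (cases "d j = 0")
    case False
    then have "c * (d j * (x $ j)\<^sup>2) \<le> d j * (d j * (x $ j)\<^sup>2)"
      using d by (intro mult_right_mono) auto
    then show ?thesis by (simp add: power2_eq_square mult_ac)
  qed simp
  then show "c * (norm (Y *v x))\<^sup>2 \<le> (norm ((transpose Y ** Y) *v x))\<^sup>2"
    unfolding Yx YYx sum_distrib_left by (rule sum_mono)
  show "c * (norm x)\<^sup>2 \<le> (norm (Y *v x))\<^sup>2" if "\<And>j. d j \<noteq> 0"
    unfolding Yx x sum_distrib_left using d(2)[OF that] by (intro sum_mono mult_right_mono) auto
qed

lemma orthogonal_matrix_norm:
  fixes R :: "real^'r^'r"
  assumes "orthogonal_matrix R"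
  shows "norm (R *v x) = norm x"
  using gram_form[of x R R x] assms
  by (simp add: orthogonal_matrix norm_eq_sqrt_inner)

lemma norm_mult_transpose_ge:
  fixes D :: "real^'r^'m" and Y :: "real^'r^'n"
  assumes "\<And>x. c * (norm x)\<^sup>2 \<le> (norm (Y *v x))\<^sup>2"
  shows "c * (norm D)\<^sup>2 \<le> (norm (D ** transpose Y))\<^sup>2"
proof -
  have row: "(D ** transpose Y) $ i = Y *v (D $ i)" for i
    unfolding matrix_mult_row using transpose_matrix_vector[of "transpose Y" "D $ i"] by simp
  have sq: "(norm E)\<^sup>2 = (\<Sum>i\<in>UNIV. (norm (E $ i))\<^sup>2)" for E :: "real^'k^'m"
    by (simp add: norm_vec_def[of E] L2_set_def sum_nonneg)
  show ?thesis unfolding sq row sum_distrib_left by (intro sum_mono assms)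
qed

theorem theorem2:
  fixes f :: "real^'q^'p \<Rightarrow> real"
    and lam m M :: real
    and Xstar :: "real^'q^'p"
    and U :: "real^'r^'p"
    and V :: "real^'r^'q"
  defines "g \<equiv> factored_objective f lam :: real^'r^('p::finite + 'q::finite) \<Rightarrow> real"
    and "W \<equiv> stack U V"
  assumes "lam > 0" and "m > 0" and "M > 0"
    and "convex_on UNIV f"
    and "twice_continuously_differentiable f"
    and "restricted_well_conditioned (2 * CARD('r)) (4 * CARD('r)) m M f"
    and "convex_optimal f lam Xstar"
    and "rank Xstar \<le> CARD('r)"
    and "critical_point g W"
  shows "U ** transpose V = Xstar \<or>
    (strict_saddle g W \<and>
     lambda_min (hessian_matrix g W) < 0 \<and>
     (CARD('r) \<ge> rank Xstar \<longrightarrow>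
        lambda_min (hessian_matrix g W) \<le> - 0.12 * m * min (0.5 * (rho W)\<^sup>2) (rho Xstar)) \<and>
     (CARD('r) = rank Xstar \<longrightarrow>
        lambda_min (hessian_matrix g W) \<le> - 0.099 * m * rho Xstar) \<and>
     (W = 0 \<longrightarrow>
        lambda_min (hessian_matrix g W) \<le> - 0.12 * m * rho Xstar))"
proof (subst disj_commute, rule disjCI)
  assume ne: "U ** transpose V \<noteq> Xstar"
  obtain f1 f2 where so: "second_order_derivatives f f1 f2"
    and so_g: "second_order_derivatives g
      (\<lambda>W D. f1 (block_product W) (block_product_deriv W D) + lam * (W \<bullet> D))
      (\<lambda>W G D. f2 (block_product W) (block_product_deriv W G) (block_product_deriv W D)
         + f1 (block_product W) (block_product_deriv G D) + lam * (G \<bullet> D))"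
    unfolding g_def
    by (rule twice_continuously_differentiable_second_order[OF assms(7), where 'r = 'r]) blast
  have f1: "(f has_derivative f1 X) (at X)" for X
    using so by (simp add: second_order_derivatives_def)
  have wc: "m * (norm D)\<^sup>2 \<le> f2 Z D D \<and> f2 Z D D \<le> M * (norm D)\<^sup>2"
    if "rank Z \<le> 2 * CARD('r)" "rank D \<le> 4 * CARD('r)" for Z D
    using assms(8) that unfolding restricted_well_conditioned_def hessian_form_eq[OF so] by blast
  have Mm: "M \<le> 1.5 * m"
    using assms(8) \<open>m > 0\<close> by (simp add: restricted_well_conditioned_def divide_le_eq)
  have critW: "f1 (block_product W) (block_product_deriv W D) + lam * (W \<bullet> D) = 0" for D
    using so_g \<open>critical_point g W\<close> critical_point_derivative_zero unfolding second_order_derivatives_def by blast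
  have XW: "block_product W = U ** transpose V" by (simp add: block_product_def W_def)

  obtain Y0 :: "real^'r^('p + 'q)" and d where Y0: "block_product Y0 = Xstar"
    and gram0: "transpose Y0 ** Y0 = diag d"
    and d: "\<And>j. 0 \<le> d j" "\<And>j. d j \<noteq> 0 \<Longrightarrow> 2 * rho Xstar \<le> d j"
    and full: "\<And>j. rank Xstar = CARD('r) \<Longrightarrow> d j \<noteq> 0"
    and crit0: "\<And>D. f1 Xstar (block_product_deriv Y0 D) + lam * (Y0 \<bullet> D) = 0"
    and dual: "\<And>W :: real^'r^('p + 'q). 0 \<le> f1 Xstar (block_product W) + lam / 2 * (W \<bullet> W)"
    using convex_optimal_factor[OF f1 assms(9) \<open>lam > 0\<close> assms(10)] by metis
  (* Multiplying the factor by an orthogonal matrix from the right changes neither its product nor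
     its stationarity. *)
  obtain R where R: "orthogonal_matrix R"
    and sym0: "transpose (transpose W ** Y0 ** R) = transpose W ** Y0 ** R"
    and psd0: "\<And>x. 0 \<le> x \<bullet> ((transpose W ** Y0 ** R) *v x)"
    using procrustes_alignment[of "transpose W ** Y0"] by blast
  define Y where "Y = Y0 ** R"
  have RR: "R ** transpose R = mat 1" using R by (simp add: orthogonal_matrix_def)
  have sym: "transpose (transpose W ** Y) = transpose W ** Y"
    and psd: "\<And>x. 0 \<le> x \<bullet> ((transpose W ** Y) *v x)"
    using sym0 psd0 by (simp_all add: Y_def matrix_mul_assoc)
  have XY: "block_product Y = Xstar"
    by (simp add: Y0[symmetric] Y_def block_product_def block_of_mult matrix_transpose_mul)
       (metis RR matrix_mul_assoc matrix_mul_rid)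
  have critY: "f1 (block_product Y) (block_product_deriv Y D) + lam * (Y \<bullet> D) = 0" for D
  proof -
    have "block_product_deriv Y D = block_product_deriv Y0 (D ** transpose R)"
      unfolding block_product_deriv_mult_transpose
      by (simp add: block_product_deriv_commute Y_def)
    moreover have "Y \<bullet> D = Y0 \<bullet> (D ** transpose R)" by (simp add: Y_def inner_matrix_mult_left)
    ultimately show ?thesis using crit0 by (simp add: XY)
  qed
  define D where "D = W - Y"
  define gap where "gap = (norm (W ** transpose W - Y ** transpose Y))\<^sup>2"
  define h where "h = (norm (block_product W - block_product Y))\<^sup>2"
  define \<mu> where "\<mu> = lambda_min (hessian_matrix g W)"
  have h: "h > 0" using ne by (simp add: h_def XW XY)
  have D: "D \<noteq> 0" using ne XW XY by (auto simp: D_def)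
  have dual': "0 \<le> f1 (block_product Y) (block_product W) + lam / 2 * (W \<bullet> W)" for W :: "real^'r^('p + 'q)"
    using dual by (simp add: XY)
  note main = hessian_descent_direction[OF so wc Mm \<open>m > 0\<close> \<open>M > 0\<close> \<open>lam > 0\<close> critW critY dual' sym psd]
  have \<mu>h: "\<mu> * (norm D)\<^sup>2 \<le> - 0.41 * m * h"
    using lambda_min_hessian_le[OF so_g, of W D] main(1)
    unfolding \<mu>_def D_def[symmetric] h_def[symmetric] by linarith
  have gap: "gap \<le> 4 * h" using main(2) by (simp add: gap_def h_def)
  have "m * h > 0" using h \<open>m > 0\<close> by simp
  with \<mu>h have "\<mu> * (norm D)\<^sup>2 < 0" by simp
  then have neg: "\<mu> < 0" by (simp add: mult_less_0_iff)
  (* 0.1025 = 0.41 / 4, as gap \<le> 4 h *)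
  have bound: "\<mu> \<le> - 0.1025 * m * \<alpha>" if "\<alpha> * (norm D)\<^sup>2 \<le> gap" for \<alpha>
  proof -
    have "m * (\<alpha> * (norm D)\<^sup>2) \<le> m * (4 * h)"
      using that gap \<open>m > 0\<close> by (intro mult_left_mono) auto
    then have "\<mu> * (norm D)\<^sup>2 \<le> (- 0.1025 * m * \<alpha>) * (norm D)\<^sup>2" using \<mu>h by simp
    then show ?thesis by (rule mult_right_le_imp_le) (use D in simp)
  qed
  have factor_bound: "2 * rho Xstar * (norm (Y *v x))\<^sup>2 \<le> (norm ((transpose Y ** Y) *v x))\<^sup>2" for x
  proof -
    have "(transpose Y ** Y) *v x = transpose R *v ((transpose Y0 ** Y0) *v (R *v x))"
      by (simp add: Y_def matrix_transpose_mul matrix_vector_mul_assoc matrix_mul_assoc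
          del: transpose_matrix_vector)
    then have "norm ((transpose Y ** Y) *v x) = norm ((transpose Y0 ** Y0) *v (R *v x))"
      using R orthogonal_matrix_norm[of "transpose R"] by simp
    moreover have "Y *v x = Y0 *v (R *v x)" by (simp add: Y_def matrix_vector_mul_assoc)
    ultimately show ?thesis
      using gram_diag_bounds(1)[OF gram0 d, of "R *v x"] by simp
  qed
  have rho0: "0 \<le> rho Xstar" by (rule rho_nonneg)
  have case1: "\<mu> \<le> - 0.12 * m * min (0.5 * (rho W)\<^sup>2) (rho Xstar)"
  proof -
    define \<alpha> where "\<alpha> = min ((rho W)\<^sup>2) (2 * rho Xstar)"
    have \<alpha>: "0 \<le> \<alpha>" "\<alpha> \<le> (rho W)\<^sup>2" "\<alpha> \<le> 2 * rho Xstar" using rho0 by (auto simp: \<alpha>_def)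
    have "\<alpha> * (norm (W *v x))\<^sup>2 \<le> (norm ((transpose W ** W) *v x))\<^sup>2" for x
      using mult_right_mono[OF \<alpha>(2), of "(norm (W *v x))\<^sup>2"] rho_gram_bound[of W x] by simp
    moreover have "\<alpha> * (norm (Y *v x))\<^sup>2 \<le> (norm ((transpose Y ** Y) *v x))\<^sup>2" for x
      using mult_right_mono[OF \<alpha>(3), of "(norm (Y *v x))\<^sup>2"] factor_bound[of x] by simp
    ultimately have "\<alpha> * (norm D)\<^sup>2 \<le> gap"
      unfolding D_def gap_def
      by (intro gram_difference_ge_factor_difference[OF sym psd \<alpha>(1)])
    then have "\<mu> \<le> - 0.1025 * m * \<alpha>" by (rule bound)
    moreover have min_eq: "min (0.5 * (rho W)\<^sup>2) (rho Xstar) = \<alpha> / 2" by (simp add: \<alpha>_def min_def)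
    moreover have "0 \<le> m * \<alpha>" using \<alpha>(1) \<open>m > 0\<close> by simp
    ultimately show ?thesis unfolding min_eq by simp
  qed
  have mrho: "0 \<le> m * rho Xstar" using rho0 \<open>m > 0\<close> by simp
  have case2: "\<mu> \<le> - 0.099 * m * rho Xstar" if "CARD('r) = rank Xstar"
  proof -
    have "2 * rho Xstar * (norm x)\<^sup>2 \<le> (norm (Y *v x))\<^sup>2" for x
      using gram_diag_bounds(2)[OF gram0 d full, of "R *v x"] that orthogonal_matrix_norm[OF R, of x]
      by (simp add: Y_def matrix_vector_mul_assoc)
    then have "2 * rho Xstar * (norm D)\<^sup>2 \<le> (norm (D ** transpose Y))\<^sup>2"
      by (rule norm_mult_transpose_ge)
    (* The roles of W and Y are exchanged, since only Y is known to have full column rank. *)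
    moreover have "2/3 * (norm (D ** transpose Y))\<^sup>2 \<le> gap"
    proof -
      have S: "transpose Y ** W = transpose W ** Y" using sym by (simp add: matrix_transpose_mul)
      have "(Y - W) ** transpose Y = - (D ** transpose Y)" by (simp add: D_def matrix_mult_distribs)
      then have "norm ((Y - W) ** transpose Y) = norm (D ** transpose Y)" by simp
      moreover have "norm (Y ** transpose Y - W ** transpose W) = norm (W ** transpose W - Y ** transpose Y)"
        by (rule norm_minus_commute)
      ultimately show ?thesis
        using gram_difference_lower_bound[of Y W, unfolded S, OF sym psd] by (simp add: gap_def)
    qed
    ultimately have "(4/3 * rho Xstar) * (norm D)\<^sup>2 \<le> gap" by simp
    then have "\<mu> \<le> - 0.1025 * m * (4/3 * rho Xstar)" by (rule bound)
    then show ?thesis using mrho by simp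
  qed
  have case3: "\<mu> \<le> - 0.12 * m * rho Xstar" if "W = 0"
  proof -
    have "2 * rho Xstar * (norm D)\<^sup>2 \<le> gap"
      unfolding D_def gap_def
      by (intro gram_difference_ge_factor_difference[OF sym psd _ _ factor_bound])
         (use rho0 that in simp_all)
    then have "\<mu> \<le> - 0.1025 * m * (2 * rho Xstar)" by (rule bound)
    then show ?thesis using mrho by simp
  qed
  have "eigenvalue (hessian_matrix g W) \<mu>"
    unfolding \<mu>_def by (rule eigenvalue_lambda_min[OF hessian_matrix_symmetric[OF so_g]])
  then have "strict_saddle g W"
    using neg \<open>critical_point g W\<close> unfolding strict_saddle_def by blast
  then show "strict_saddle g W \<and>
     lambda_min (hessian_matrix g W) < 0 \<and>
     (CARD('r) \<ge> rank Xstar \<longrightarrow>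
        lambda_min (hessian_matrix g W) \<le> - 0.12 * m * min (0.5 * (rho W)\<^sup>2) (rho Xstar)) \<and>
     (CARD('r) = rank Xstar \<longrightarrow>
        lambda_min (hessian_matrix g W) \<le> - 0.099 * m * rho Xstar) \<and>
     (W = 0 \<longrightarrow>
        lambda_min (hessian_matrix g W) \<le> - 0.12 * m * rho Xstar)"
    using neg case1 case2 case3 unfolding \<mu>_def by blast
qed

end
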